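(* (Uniform case.) Let $Q\subset\mathbb R^m$ be a polytope of dimension $d$, let $\boldsymbol c$ be uniformly distributed on $Q$ (with respect to the Lebesgue measure of the affine hull of $Q$), and let $S\subset Q$ be a simplex with $\dim S=\dim Q$. Then $$\check p_S=\frac{\operatorname{Vol}_d(S)}{\operatorname{Vol}_d(Q)},\qquad \check c_S=\frac1{d+1}\sum_{v\in\operatorname{Vert}(S)}v.$$ (Exponential case.) Let $K\subset\mathbb R^m$ be a (not necessarily simplicial) polyhedral cone and let $\theta\in\operatorname{ri}(K^\circ)$. Let $\boldsymbol c$ have the exponential law $$d\mathbb P(c)=\frac{e^{\theta^\top c}\,\mathbf 1_{c\in K}}{\Phi_K(\theta)}\,d\mathcal L_{\operatorname{aff}(K)}(c),$$ and let $S\subset K$ be a simplicial cone with $\dim S=\dim K$. Then $$\check p_S=\frac{\Phi_S(\theta)}{\Phi_K(\theta)}=\frac{|\det(\operatorname{Ray}(S))|}{\Phi_K(\theta)}\prod_{r\in\operatorname{Ray}(S)}\frac1{-r^\top\theta},\qquad \check c_S=\Big(\sum_{r\in\operatorname{Ray}(S)}\frac{-r_i}{r^\top\theta}\Big)_{i\in[m]}.$$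
   Context: For a random vector $\boldsymbol c$ in $\mathbb R^m$ and a polyhedron $S$: $\check p_S:=\mathbb P[\boldsymbol c\in\operatorname{ri}(S)]$ and $\check c_S:=\mathbb E[\boldsymbol c\mid\boldsymbol c\in\operatorname{ri}(S)]$ if $\check p_S>0$ ($\check c_S:=0$ otherwise), where $\operatorname{ri}$ is the relative interior. $\operatorname{aff}(A)$ is the affine hull of $A$, $\mathcal L_{\operatorname{aff}(A)}$ the Lebesgue measure on it, $\operatorname{Vol}_d$ the $d$-dimensional volume in the affine hull, $\operatorname{Vert}(S)$ the set of vertices of $S$, and $[m]=\{1,\dots,m\}$. A simplex of dimension $d$ is the convex hull of $d+1$ affinely independent points; a simplicial cone of dimension $k$ is the conical hull of $k$ linearly independent vectors. $\operatorname{Ray}(S)$ is a set consisting of exactly one nonzero vector from each extreme ray of $S$, also viewed as the matrix having these vectors as columns; it is square when $S$ is full-dimensional, and when $\dim S<m$ its determinant is understood after expressing the columns in an orthonormal basis of the linear span of $S$. $K^\circ=\{\alpha:\alpha^\top x\le0\ \forall x\in K\}$ is the polar cone, and for a polyhedral cone $C$, $\Phi_C(\theta):=\int_C e^{\theta^\top c}\,d\mathcal L_{\operatorname{aff}(C)}(c)$; $\Phi_K(\theta)$ is finite, as is implicit in the definition of the law of $\boldsymbol c$. *)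

theory Defs
  imports "HOL-Probability.Probability" "Jordan_Normal_Form.Determinant"
begin

no_notation vec_index (infixl "$" 100)
no_notation scalar_prod (infix "\<bullet>" 70)

definition orthonormal_basis_of :: "'a::euclidean_space set \<Rightarrow> 'a set \<Rightarrow> bool" where
  "orthonormal_basis_of V B \<longleftrightarrow> pairwise (\<lambda>x y. x \<bullet> y = 0) B \<and> (\<forall>b\<in>B. norm b = 1) \<and> span B = V"

definition aff_direction :: "'a::euclidean_space set \<Rightarrow> 'a set" where
  "aff_direction A = {x - y | x y. x \<in> affine hull A \<and> y \<in> affine hull A}"

(* Lebesgue measure on the affine hull of A, regarded as a Borel measure on the whole space: the image
   of Lebesgue measure on coordinate space under an isometric parametrization. By rotation and
   translation invariance it does not depend on the chosen basis and origin; it is a function of the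
   affine hull of A only, and is a Dirac measure when A is a single point. The empty set is a junk case. *)
definition aff_lebesgue :: "'a::euclidean_space set \<Rightarrow> 'a measure" where
  "aff_lebesgue A =
    (let B = (SOME B. orthonormal_basis_of (aff_direction A) B);
         a = (SOME a. a \<in> affine hull A)
     in distr (Pi\<^sub>M B (\<lambda>_. lborel)) borel (\<lambda>t. a + (\<Sum>b\<in>B. t b *\<^sub>R b)))"

definition aff_volume :: "'a::euclidean_space set \<Rightarrow> real" where
  "aff_volume A = measure (aff_lebesgue A) A"

definition polyhedral_cone :: "'a::euclidean_space set \<Rightarrow> bool" where
  "polyhedral_cone K \<longleftrightarrow> polyhedron K \<and> convex_cone K"

definition simplicial_cone :: "nat \<Rightarrow> 'a::euclidean_space set \<Rightarrow> bool" where
  "simplicial_cone k S \<longleftrightarrow> (\<exists>R. independent R \<and> card R = k \<and> S = convex_cone hull R)"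

definition polar_cone :: "'a::euclidean_space set \<Rightarrow> 'a set" where
  "polar_cone K = {\<alpha>. \<forall>x\<in>K. \<alpha> \<bullet> x \<le> 0}"

definition Vert :: "'a::euclidean_space set \<Rightarrow> 'a set" where
  "Vert S = {v. v extreme_point_of S}"

definition extreme_ray_of :: "'a::euclidean_space set \<Rightarrow> 'a set \<Rightarrow> bool" (infixr "extreme'_ray'_of" 50) where
  "F extreme_ray_of S \<longleftrightarrow> F face_of S \<and> (\<exists>r. r \<noteq> 0 \<and> F = conic hull {r})"

(* Ray(S) is determined only up to positive scaling of its elements, hence a predicate. *)
definition is_Ray :: "'a::euclidean_space set \<Rightarrow> 'a set \<Rightarrow> bool" where
  "is_Ray S R \<longleftrightarrow>
    (\<forall>r\<in>R. r \<noteq> 0 \<and> (\<exists>F. F extreme_ray_of S \<and> r \<in> F)) \<and>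
    (\<forall>F. F extreme_ray_of S \<longrightarrow> (\<exists>!r. r \<in> R \<and> r \<in> F))"

(* The matrix with columns rs, expressed in the ordered orthonormal basis bs. *)
definition ray_matrix :: "'a::euclidean_space list \<Rightarrow> 'a list \<Rightarrow> real Matrix.mat" where
  "ray_matrix bs rs = Matrix.mat (length bs) (length rs) (\<lambda>(i, j). (bs ! i) \<bullet> (rs ! j))"

definition exp_integral :: "'a::euclidean_space set \<Rightarrow> 'a \<Rightarrow> real" where
  "exp_integral C \<theta> = set_lebesgue_integral (aff_lebesgue C) C (\<lambda>c. exp (\<theta> \<bullet> c))"

definition exp_law :: "'a::euclidean_space set \<Rightarrow> 'a \<Rightarrow> 'a measure" where
  "exp_law K \<theta> =
    density (aff_lebesgue K) (\<lambda>c. ennreal (exp (\<theta> \<bullet> c) * indicator K c / exp_integral K \<theta>))"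

definition ri_event :: "'w measure \<Rightarrow> ('w \<Rightarrow> 'a::euclidean_space) \<Rightarrow> 'a set \<Rightarrow> 'w set" where
  "ri_event M c S = {\<omega> \<in> space M. c \<omega> \<in> rel_interior S}"

definition check_p :: "'w measure \<Rightarrow> ('w \<Rightarrow> 'a::euclidean_space) \<Rightarrow> 'a set \<Rightarrow> real" where
  "check_p M c S = measure M (ri_event M c S)"

definition check_c :: "'w measure \<Rightarrow> ('w \<Rightarrow> 'a::euclidean_space) \<Rightarrow> 'a set \<Rightarrow> 'a" where
  "check_c M c S =
    (if check_p M c S > 0 then integral\<^sup>L (uniform_measure M (ri_event M c S)) c else 0)"

end

theory Submission
  imports Defs
begin

text \<open>
  A uniform law and an exponential law on a polyhedron are laws with a density with respect to the
  Lebesgue measure of an affine hull. Since \<open>S\<close> has the same affine hull as the support, both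
  quantities reduce to integrals over \<open>S\<close> with respect to that measure, provided that the relative
  boundary of \<open>S\<close> is null (\<open>check_density\<close>).

  A simplex and a simplicial cone are images of the corner \<open>t \<ge> 0, \<Sum>t \<le> 1\<close> and of the orthant
  \<open>t \<ge> 0\<close> under an affine chart built from the edges at a vertex or from the generators. In such a
  chart the measure is a constant times product Lebesgue measure, and the constant is the
  absolute value of the determinant of the chart vectors in an orthonormal frame
  (\<open>aff_lebesgue_chart\<close>). Dimension varies here, so this Jacobian formula is proved for matrices of
  arbitrary size: a matrix that replaces a single row of the identity changes one coordinate and
  is handled by Fubini, and Gaussian elimination writes every invertible matrix as a product of
  these (\<open>scales_by_det_elimination\<close>).

  For a simplex, exchanging two barycentric coordinates preserves the measure. Hence all of them
  have the same mean, namely \<open>1 / (d + 1)\<close>, which gives the barycenter of the vertices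
  (\<open>simplex_integrals\<close>). For a cone, the exponential is a product of functions of the single
  coordinates, so its integral and first moments are products of one-dimensional ones
  (\<open>cone_integrals\<close>). It remains to see that any choice of representatives of the extreme rays is,
  up to positive factors, the given set of generators (\<open>is_Ray_simplicial_cone\<close>).
\<close>

section \<open>Linear change of variables in coordinate space\<close>

abbreviation leb :: "nat \<Rightarrow> (nat \<Rightarrow> real) measure" where
  "leb d \<equiv> Pi\<^sub>M {..<d} (\<lambda>_. lborel)"

text \<open>Fubini in the coordinate \<open>k\<close>: with the other coordinates fixed, \<open>c * t k + g t\<close> is an affine
  function of one real variable. Translations and invertible matrices are composed of such steps.\<close>

lemma nn_integral_leb_update:
  assumes k: "k < d" and c: "c \<noteq> 0"
    and [measurable]: "F \<in> borel_measurable (leb d)" "g \<in> borel_measurable (leb d)"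
    and indep: "\<And>t x. g (t(k := x)) = g t"
  shows "(\<integral>\<^sup>+ t. F t \<partial>leb d) = ennreal \<bar>c\<bar> * (\<integral>\<^sup>+ t. F (t(k := c * t k + g t)) \<partial>leb d)"
proof -
  interpret product_sigma_finite "\<lambda>_::nat. lborel :: real measure" ..
  define I where "I = {..<d} - {k}"
  have I: "finite I" "k \<notin> I" and ins: "{..<d} = insert k I"
    using k by (auto simp: I_def)
  have F': "F \<in> borel_measurable (Pi\<^sub>M (insert k I) (\<lambda>_. lborel))"
    using assms(3) ins by simp
  have comp: "(\<lambda>t. t k) \<in> borel_measurable (leb d)"
    using measurable_component_singleton[of k "{..<d}" "\<lambda>_. lborel :: real measure"] k by simp
  have upd [measurable]: "(\<lambda>t. t(k := c * t k + g t)) \<in> measurable (leb d) (leb d)"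
  proof -
    have "(\<lambda>t. (t, c * t k + g t)) \<in> measurable (leb d) (leb d \<Otimes>\<^sub>M lborel)"
      by (intro measurable_Pair measurable_ident_sets[OF refl] borel_measurable_add
          borel_measurable_times borel_measurable_const) (use comp assms in auto)
    moreover have "(\<lambda>(t, y). t(k := y)) \<in> measurable (leb d \<Otimes>\<^sub>M lborel) (leb d)"
      using k measurable_add_dim[of k "{..<d}" "\<lambda>_. lborel"] by (simp add: insert_absorb)
    ultimately have "(\<lambda>(t, y). t(k := y)) \<circ> (\<lambda>t. (t, c * t k + g t)) \<in> measurable (leb d) (leb d)"
      by (rule measurable_comp)
    then show ?thesis by (simp add: comp_def)
  qed
  have "(\<integral>\<^sup>+ t. F t \<partial>leb d) = (\<integral>\<^sup>+ x. (\<integral>\<^sup>+ y. F (x(k := y)) \<partial>lborel) \<partial>Pi\<^sub>M I (\<lambda>_. lborel))"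
    using product_nn_integral_insert[OF I F'] ins by simp
  also have "\<dots> = (\<integral>\<^sup>+ x. ennreal \<bar>c\<bar> * (\<integral>\<^sup>+ y. F (x(k := c * y + g x)) \<partial>lborel) \<partial>Pi\<^sub>M I (\<lambda>_. lborel))"
  proof (rule nn_integral_cong)
    fix x assume x: "x \<in> space (Pi\<^sub>M I (\<lambda>_. lborel :: real measure))"
    have [measurable]: "(\<lambda>y. F (x(k := y))) \<in> borel_measurable borel"
      using measurable_comp[OF measurable_component_update[OF x I(2)] F'] by (simp add: comp_def)
    show "(\<integral>\<^sup>+ y. F (x(k := y)) \<partial>lborel) = ennreal \<bar>c\<bar> * (\<integral>\<^sup>+ y. F (x(k := c * y + g x)) \<partial>lborel)"
      by (subst nn_integral_real_affine[OF _ c, where t = "g x"]) (auto simp: add.commute)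
  qed
  also have "\<dots> = ennreal \<bar>c\<bar> * (\<integral>\<^sup>+ x. (\<integral>\<^sup>+ y. F (x(k := c * y + g x)) \<partial>lborel) \<partial>Pi\<^sub>M I (\<lambda>_. lborel))"
  proof (rule nn_integral_cmult)
    have m: "(\<lambda>(x, y). x(k := y)) \<in> measurable (Pi\<^sub>M I (\<lambda>_. lborel) \<Otimes>\<^sub>M lborel) (leb d)"
      unfolding ins by (rule measurable_add_dim)
    have "(\<lambda>(x, y). F ((\<lambda>t. t(k := c * t k + g t)) (x(k := y)))) \<in> borel_measurable (Pi\<^sub>M I (\<lambda>_. lborel) \<Otimes>\<^sub>M lborel)"
      using measurable_comp[OF m, of "\<lambda>t. F (t(k := c * t k + g t))" borel]
      by (simp add: comp_def split_def)
    then have "(\<lambda>(x, y). F (x(k := c * y + g x))) \<in> borel_measurable (Pi\<^sub>M I (\<lambda>_. lborel) \<Otimes>\<^sub>M lborel)"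
      by (simp add: indep)
    from sigma_finite_measure.borel_measurable_nn_integral[OF _ this]
    show "(\<lambda>x. \<integral>\<^sup>+ y. F (x(k := c * y + g x)) \<partial>lborel) \<in> borel_measurable (Pi\<^sub>M I (\<lambda>_. lborel))"
      by (simp add: sigma_finite_lborel)
  qed
  also have "(\<integral>\<^sup>+ x. (\<integral>\<^sup>+ y. F (x(k := c * y + g x)) \<partial>lborel) \<partial>Pi\<^sub>M I (\<lambda>_. lborel))
      = (\<integral>\<^sup>+ t. F (t(k := c * t k + g t)) \<partial>leb d)"
  proof -
    have "(\<lambda>t. F (t(k := c * t k + g t))) \<in> borel_measurable (leb d)" by measurable
    then have "(\<lambda>t. F (t(k := c * t k + g t))) \<in> borel_measurable (Pi\<^sub>M (insert k I) (\<lambda>_. lborel))"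
      by (simp only: ins)
    from product_nn_integral_insert[OF I this] show ?thesis
      by (simp add: indep ins)
  qed
  finally show ?thesis .
qed

definition lin :: "nat \<Rightarrow> real Matrix.mat \<Rightarrow> (nat \<Rightarrow> real) \<Rightarrow> nat \<Rightarrow> real" where
  "lin d A t = (\<lambda>i\<in>{..<d}. \<Sum>j<d. A $$ (i, j) * t j)"

lemma measurable_lin [measurable]: "lin d A \<in> measurable (leb d) (leb d)"
  unfolding lin_def by measurable

text \<open>The change-of-variables formula is required of all nonnegative integrands, so that the
  property is visibly inherited by products of matrices.\<close>

definition scales_by_det :: "nat \<Rightarrow> real Matrix.mat \<Rightarrow> bool" where
  "scales_by_det d A \<longleftrightarrow> (\<forall>F\<in>borel_measurable (leb d).
     (\<integral>\<^sup>+ t. F t \<partial>leb d) = ennreal \<bar>Determinant.det A\<bar> * (\<integral>\<^sup>+ t. F (lin d A t) \<partial>leb d))"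

lemma lin_mult:
  assumes "A \<in> carrier_mat d d" "B \<in> carrier_mat d d"
  shows "lin d (A * B) t = lin d A (lin d B t)"
proof -
  have "(\<Sum>j<d. (A * B) $$ (i, j) * t j) = (\<Sum>j<d. A $$ (i, j) * (\<Sum>l<d. B $$ (j, l) * t l))"
    if "i < d" for i
  proof -
    have "(\<Sum>j<d. (A * B) $$ (i, j) * t j) = (\<Sum>j<d. \<Sum>l<d. A $$ (i, l) * B $$ (l, j) * t j)"
      using assms that
      by (intro sum.cong) (auto simp: Matrix.scalar_prod_def sum_distrib_right atLeast0LessThan)
    also have "\<dots> = (\<Sum>l<d. \<Sum>j<d. A $$ (i, l) * B $$ (l, j) * t j)"
      by (rule sum.swap)
    finally show ?thesis by (simp add: sum_distrib_left mult.assoc)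
  qed
  then show ?thesis
    unfolding lin_def by (auto simp: restrict_def)
qed

lemma scales_by_det_mult:
  assumes A: "A \<in> carrier_mat d d" "scales_by_det d A"
    and B: "B \<in> carrier_mat d d" "scales_by_det d B"
  shows "scales_by_det d (A * B)"
  unfolding scales_by_det_def
proof
  fix F :: "(nat \<Rightarrow> real) \<Rightarrow> ennreal" assume [measurable]: "F \<in> borel_measurable (leb d)"
  have "(\<integral>\<^sup>+ t. F t \<partial>leb d) = ennreal \<bar>Determinant.det A\<bar> * (\<integral>\<^sup>+ t. F (lin d A t) \<partial>leb d)"
    using A(2)[unfolded scales_by_det_def, rule_format, of F] by simp
  also have "(\<integral>\<^sup>+ t. F (lin d A t) \<partial>leb d)
      = ennreal \<bar>Determinant.det B\<bar> * (\<integral>\<^sup>+ t. F (lin d A (lin d B t)) \<partial>leb d)"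
    by (rule B(2)[unfolded scales_by_det_def, rule_format]) measurable
  finally show "(\<integral>\<^sup>+ t. F t \<partial>leb d)
      = ennreal \<bar>Determinant.det (A * B)\<bar> * (\<integral>\<^sup>+ t. F (lin d (A * B) t) \<partial>leb d)"
    unfolding lin_mult[OF A(1) B(1)] Determinant.det_mult[OF A(1) B(1)]
    by (simp only: abs_mult ennreal_mult[OF abs_ge_zero abs_ge_zero] mult.assoc)
qed

text \<open>The identity matrix with row \<open>k\<close> replaced by \<open>\<alpha>\<close>. Acting on vectors it changes one coordinate only;
  multiplying a matrix from the left it replaces row \<open>k\<close> by a linear combination of the rows.\<close>

definition row_replacement :: "nat \<Rightarrow> nat \<Rightarrow> (nat \<Rightarrow> real) \<Rightarrow> real Matrix.mat" where
  "row_replacement d k \<alpha> = Matrix.mat d d (\<lambda>(i, j). if i = k then \<alpha> j else if i = j then 1 else 0)"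

lemma row_replacement_carrier [simp]: "row_replacement d k \<alpha> \<in> carrier_mat d d"
  by (simp add: row_replacement_def)

text \<open>In the Leibniz sum a permutation contributes only if it fixes every index other than \<open>k\<close>, and
  such a permutation is the identity.\<close>

lemma det_row_replacement:
  assumes k: "k < d"
  shows "Determinant.det (row_replacement d k \<alpha>) = \<alpha> k"
proof -
  let ?X = "row_replacement d k \<alpha>"
  have other: "signof p * (\<Prod>i = 0..<d. ?X $$ (i, p i)) = 0"
    if p: "p permutes {0..<d}" and ne: "p \<noteq> id" for p
  proof -
    have "\<exists>i. i \<noteq> k \<and> p i \<noteq> i"
    proof (rule ccontr)
      assume "\<not> ?thesis"
      then have fixed: "p i = i" if "i \<noteq> k" for i using that by blast
      have "p k = k"
        using fixed[of "p k"] permutes_inj[OF p] by (metis injD)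
      with fixed have "p = id" by (metis eq_id_iff)
      with ne show False by simp
    qed
    then obtain i where i: "i \<noteq> k" "p i \<noteq> i" by blast
    with p have "i \<in> {0..<d}" by (meson permutes_not_in)
    moreover have "p i \<in> {0..<d}" using p calculation by (simp only: permutes_in_image)
    ultimately have "?X $$ (i, p i) = 0"
      using i by (simp add: row_replacement_def)
    with \<open>i \<in> {0..<d}\<close> show ?thesis by (metis finite_atLeastLessThan mult_zero_right prod_zero)
  qed
  have "Determinant.det ?X = (\<Sum>p\<in>{p. p permutes {0..<d}}. signof p * (\<Prod>i = 0..<d. ?X $$ (i, p i)))"
    by (rule Determinant.det_def'[OF row_replacement_carrier])
  also have "\<dots> = (\<Sum>p\<in>{id}. signof p * (\<Prod>i = 0..<d. ?X $$ (i, p i)))"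
    by (rule sum.mono_neutral_right) (auto simp: other finite_permutations permutes_id)
  also have "\<dots> = (\<Prod>i = 0..<d. ?X $$ (i, i))" by simp
  also have "\<dots> = (\<Prod>i = 0..<d. if i = k then \<alpha> k else 1)"
    by (intro prod.cong refl) (auto simp: row_replacement_def)
  also have "\<dots> = \<alpha> k" using k by simp
  finally show ?thesis .
qed

lemma scales_by_det_row_replacement:
  assumes k: "k < d" and \<alpha>: "\<alpha> k \<noteq> 0"
  shows "scales_by_det d (row_replacement d k \<alpha>)"
  unfolding scales_by_det_def
proof
  fix F :: "(nat \<Rightarrow> real) \<Rightarrow> ennreal" assume F [measurable]: "F \<in> borel_measurable (leb d)"
  define g where "g t = (\<Sum>j\<in>{..<d} - {k}. \<alpha> j * t j)" for t :: "nat \<Rightarrow> real"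
  have g [measurable]: "g \<in> borel_measurable (leb d)"
    unfolding g_def by measurable
  have "(\<integral>\<^sup>+ t. F t \<partial>leb d) = ennreal \<bar>\<alpha> k\<bar> * (\<integral>\<^sup>+ t. F (t(k := \<alpha> k * t k + g t)) \<partial>leb d)"
    by (rule nn_integral_leb_update[OF k \<alpha> F g]) (auto simp: g_def intro!: sum.cong)
  also have "(\<integral>\<^sup>+ t. F (t(k := \<alpha> k * t k + g t)) \<partial>leb d)
      = (\<integral>\<^sup>+ t. F (lin d (row_replacement d k \<alpha>) t) \<partial>leb d)"
  proof (rule nn_integral_cong)
    fix t assume t: "t \<in> space (leb d)"
    have "t(k := \<alpha> k * t k + g t) = lin d (row_replacement d k \<alpha>) t"
    proof
      fix i
      show "(t(k := \<alpha> k * t k + g t)) i = lin d (row_replacement d k \<alpha>) t i"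
      proof (cases "i < d")
        case True
        have "(\<Sum>j<d. row_replacement d k \<alpha> $$ (i, j) * t j)
            = (\<Sum>j<d. if i = k then \<alpha> j * t j else if i = j then t j else 0)"
          using True by (intro sum.cong) (auto simp: row_replacement_def)
        also have "\<dots> = (if i = k then \<alpha> k * t k + g t else t i)"
          using True k by (simp add: g_def sum.remove[of "{..<d}" k])
        finally show ?thesis using True by (simp add: lin_def)
      next
        case False
        then show ?thesis using t k by (auto simp: lin_def space_PiM PiE_def extensional_def)
      qed
    qed
    then show "F (t(k := \<alpha> k * t k + g t)) = F (lin d (row_replacement d k \<alpha>) t)" by simp
  qed
  finally show "(\<integral>\<^sup>+ t. F t \<partial>leb d) = ennreal \<bar>Determinant.det (row_replacement d k \<alpha>)\<bar>
      * (\<integral>\<^sup>+ t. F (lin d (row_replacement d k \<alpha>) t) \<partial>leb d)"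
    by (simp add: det_row_replacement[OF k])
qed

lemma dim_row_replacement [simp]:
  "dim_row (row_replacement d k \<alpha>) = d" "dim_col (row_replacement d k \<alpha>) = d"
  by (simp_all add: row_replacement_def)

lemma index_row_replacement_mult:
  assumes "B \<in> carrier_mat d d" "i < d" "j < d"
  shows "(row_replacement d k \<alpha> * B) $$ (i, j) =
    (if i = k then \<Sum>l<d. \<alpha> l * B $$ (l, j) else B $$ (i, j))"
proof -
  have "(row_replacement d k \<alpha> * B) $$ (i, j) = (\<Sum>l<d. row_replacement d k \<alpha> $$ (i, l) * B $$ (l, j))"
    using assms by (auto simp: Matrix.scalar_prod_def row_replacement_def atLeast0LessThan intro!: sum.cong)
  also have "\<dots> = (\<Sum>l<d. if i = k then \<alpha> l * B $$ (l, j) else if i = l then B $$ (l, j) else 0)"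
    using assms by (intro sum.cong) (auto simp: row_replacement_def)
  also have "\<dots> = (if i = k then \<Sum>l<d. \<alpha> l * B $$ (l, j) else B $$ (i, j))"
    using assms by simp
  finally show ?thesis .
qed

lemma scales_by_det_one: "scales_by_det d (1\<^sub>m d)"
proof -
  have lin1: "lin d (1\<^sub>m d) t = t" if "t \<in> space (leb d)" for t
  proof
    fix i
    show "lin d (1\<^sub>m d) t i = t i"
    proof (cases "i < d")
      case True
      have "(\<Sum>j<d. 1\<^sub>m d $$ (i, j) * t j) = (\<Sum>j<d. if i = j then t j else 0)"
        using True by (intro sum.cong) auto
      then show ?thesis using True by (simp add: lin_def)
    qed (use that in \<open>auto simp: lin_def space_PiM PiE_def extensional_def\<close>)
  qed
  show ?thesis
    unfolding scales_by_det_def using lin1 by (auto intro!: nn_integral_cong)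
qed

lemma left_inverse_of_det_nonzero:
  assumes A: "(A :: real Matrix.mat) \<in> carrier_mat d d" and "Determinant.det A \<noteq> 0"
  obtains N where "N \<in> carrier_mat d d" "N * A = 1\<^sub>m d"
  using det_non_zero_imp_unit[OF assms, of "()"] that
  by (auto simp: Units_def ring_mat_def)

text \<open>The steps of Gaussian elimination: \<open>A\<close> factors as a row replacement times the matrix \<open>B\<close> obtained
  from \<open>A\<close> by turning row \<open>k\<close> into a unit vector. The coefficients come from row \<open>k\<close> of \<open>N * A = 1\<close>,
  which expresses that unit vector through the rows of \<open>A\<close> and can be solved for row \<open>k\<close> of \<open>A\<close>
  because the pivot \<open>N $$ (k, k)\<close> does not vanish.\<close>

lemma scales_by_det_elimination_step:
  assumes A: "A \<in> carrier_mat d d" and dA: "Determinant.det A \<noteq> 0" and k: "k < d"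
    and unit: "\<And>i j. i < k \<Longrightarrow> j < d \<Longrightarrow> A $$ (i, j) = (if i = j then 1 else 0)"
    and N: "N \<in> carrier_mat d d" "N * A = 1\<^sub>m d" and pivot: "N $$ (k, k) \<noteq> 0"
    and IH: "\<And>B. B \<in> carrier_mat d d \<Longrightarrow> Determinant.det B \<noteq> 0 \<Longrightarrow>
      (\<And>i j. i < Suc k \<Longrightarrow> j < d \<Longrightarrow> B $$ (i, j) = (if i = j then 1 else 0)) \<Longrightarrow> scales_by_det d B"
  shows "scales_by_det d A"
proof -
  define B where "B = Matrix.mat d d (\<lambda>(i, j). if i = k then (if j = k then 1 else 0) else A $$ (i, j))"
  define \<alpha> where "\<alpha> j = (if j = k then 1 / N $$ (k, k) else - N $$ (k, j) / N $$ (k, k))" for j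
  have B: "B \<in> carrier_mat d d" by (simp add: B_def)
  have "A = row_replacement d k \<alpha> * B"
  proof (rule eq_matI)
    fix i j assume "i < dim_row (row_replacement d k \<alpha> * B)" "j < dim_col (row_replacement d k \<alpha> * B)"
    then have ij: "i < d" "j < d" using B by auto
    have "(\<Sum>l<d. N $$ (k, l) * A $$ (l, j)) = (N * A) $$ (k, j)"
      using A N(1) k ij by (auto simp: Matrix.scalar_prod_def atLeast0LessThan intro!: sum.cong)
    also have "\<dots> = (if k = j then 1 else 0)" using N(2) k ij by simp
    finally have "N $$ (k, k) * A $$ (k, j) + (\<Sum>l\<in>{..<d}-{k}. N $$ (k, l) * A $$ (l, j)) = (if k = j then 1 else 0)"
      using k by (simp add: sum.remove[of "{..<d}" k])
    then have "A $$ (k, j) = (if k = j then 1 else 0) / N $$ (k, k)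
        - (\<Sum>l\<in>{..<d}-{k}. N $$ (k, l) * A $$ (l, j)) / N $$ (k, k)"
      using pivot by (simp add: field_simps)
    also have "\<dots> = \<alpha> k * B $$ (k, j) + (\<Sum>l\<in>{..<d}-{k}. \<alpha> l * B $$ (l, j))"
      using k ij by (auto simp: \<alpha>_def B_def sum_divide_distrib sum_negf[symmetric] simp del: sum_negf intro!: sum.cong)
    also have "\<dots> = (\<Sum>l<d. \<alpha> l * B $$ (l, j))"
      using k by (simp add: sum.remove[of "{..<d}" k])
    finally show "A $$ (i, j) = (row_replacement d k \<alpha> * B) $$ (i, j)"
      using ij unfolding index_row_replacement_mult[OF B ij] by (cases "i = k") (auto simp: B_def)
  qed (use A B in auto)
  moreover from \<open>A = row_replacement d k \<alpha> * B\<close> have "Determinant.det A = \<alpha> k * Determinant.det B"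
    using Determinant.det_mult[OF row_replacement_carrier B] by (simp add: det_row_replacement[OF k])
  with dA have "\<alpha> k \<noteq> 0" "Determinant.det B \<noteq> 0" by auto
  moreover from \<open>Determinant.det B \<noteq> 0\<close> have "scales_by_det d B"
    by (rule IH[OF B]) (use k unit in \<open>auto simp: B_def less_Suc_eq\<close>)
  ultimately show ?thesis
    using B k by (simp add: scales_by_det_mult scales_by_det_row_replacement)
qed

text \<open>Downward induction on the number of leading unit rows. A vanishing pivot is repaired by subtracting
  row \<open>k\<close> of \<open>A\<close> from a later row \<open>l\<close>, which adds the nonzero entry \<open>N $$ (k, l)\<close> to the pivot.\<close>

lemma scales_by_det_elimination:
  assumes "A \<in> carrier_mat d d" "Determinant.det A \<noteq> 0" "k \<le> d"
    and "\<And>i j. i < k \<Longrightarrow> j < d \<Longrightarrow> A $$ (i, j) = (if i = j then 1 else 0)"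
  shows "scales_by_det d A"
  using assms(3,1,2,4)
proof (induction k arbitrary: A rule: inc_induct)
  case base
  then have "A = 1\<^sub>m d" by (intro eq_matI) auto
  then show ?case by (simp add: scales_by_det_one)
next
  case (step k)
  note A = step.prems(1) and dA = step.prems(2) and unit = step.prems(3) and k = step.hyps(2)
  obtain N where N: "N \<in> carrier_mat d d" "N * A = 1\<^sub>m d"
    using left_inverse_of_det_nonzero[OF A dA] .
  show ?case
  proof (cases "N $$ (k, k) = 0")
    case False
    show ?thesis
      by (rule scales_by_det_elimination_step[OF A dA k unit N False step.IH]) auto
  next
    case True
    \<comment> \<open>otherwise row \<open>k\<close> of \<open>N * A\<close> only involves unit rows of \<open>A\<close> that vanish in column \<open>k\<close>\<close>
    have "\<exists>l. k < l \<and> l < d \<and> N $$ (k, l) \<noteq> 0"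
    proof (rule ccontr)
      assume no: "\<not> ?thesis"
      have "1 = (N * A) $$ (k, k)" using N(2) k by simp
      also have "\<dots> = (\<Sum>l<d. N $$ (k, l) * A $$ (l, k))"
        using A N(1) k by (auto simp: Matrix.scalar_prod_def atLeast0LessThan intro!: sum.cong)
      also have "\<dots> = 0"
      proof (rule sum.neutral, rule ballI)
        fix l assume "l \<in> {..<d}"
        then show "N $$ (k, l) * A $$ (l, k) = 0"
          using no True unit[of l k] k by (cases l k rule: linorder_cases) auto
      qed
      finally show False by simp
    qed
    then obtain l where l: "k < l" "l < d" "N $$ (k, l) \<noteq> 0" by blast
    define \<alpha> where "\<alpha> = (\<lambda>j. if j = l \<or> j = k then 1 else 0 :: real)"
    define A' where "A' = Matrix.mat d d (\<lambda>(i, j). if i = l then A $$ (l, j) - A $$ (k, j) else A $$ (i, j))"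
    let ?R = "row_replacement d l \<alpha>"
    have A': "A' \<in> carrier_mat d d" by (simp add: A'_def)
    have AR: "A = ?R * A'"
    proof (rule eq_matI)
      fix i j assume "i < dim_row (?R * A')" "j < dim_col (?R * A')"
      then have ij: "i < d" "j < d" using A' by auto
      have "(\<Sum>m<d. \<alpha> m * A' $$ (m, j)) = (\<Sum>m\<in>{l, k}. \<alpha> m * A' $$ (m, j))"
        using l by (intro sum.mono_neutral_right) (auto simp: \<alpha>_def)
      also have "\<dots> = A $$ (l, j)"
        using l k ij by (simp add: \<alpha>_def A'_def)
      finally show "A $$ (i, j) = (?R * A') $$ (i, j)"
        using ij unfolding index_row_replacement_mult[OF A' ij] by (cases "i = l") (auto simp: A'_def)
    qed (use A A' in auto)
    have "Determinant.det A = \<alpha> l * Determinant.det A'"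
      using Determinant.det_mult[OF row_replacement_carrier A', of l \<alpha>] AR
      by (simp add: det_row_replacement[OF l(2)])
    then have dA': "Determinant.det A' \<noteq> 0" using dA by auto
    have N': "N * ?R \<in> carrier_mat d d" "N * ?R * A' = 1\<^sub>m d"
      using N A' AR by (auto simp: assoc_mult_mat[of _ d d _ d _ d])
    have "(N * ?R) $$ (k, k) = (\<Sum>m<d. N $$ (k, m) * ?R $$ (m, k))"
      using N(1) k by (auto simp: Matrix.scalar_prod_def atLeast0LessThan row_replacement_def intro!: sum.cong)
    also have "\<dots> = (\<Sum>m\<in>{l, k}. N $$ (k, m) * ?R $$ (m, k))"
      using l k by (intro sum.mono_neutral_right) (auto simp: row_replacement_def)
    also have "\<dots> = N $$ (k, l)"
      using l k True by (simp add: row_replacement_def \<alpha>_def)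
    finally have piv: "(N * ?R) $$ (k, k) \<noteq> 0" using l by simp
    have "scales_by_det d A'"
      by (rule scales_by_det_elimination_step[OF A' dA' k _ N' piv step.IH])
         (use unit l k in \<open>auto simp: A'_def\<close>)
    then show ?thesis
      using AR A' l by (simp add: scales_by_det_mult scales_by_det_row_replacement \<alpha>_def)
  qed
qed

lemma nn_integral_leb_lin:
  assumes "A \<in> carrier_mat d d" "Determinant.det A \<noteq> 0" "F \<in> borel_measurable (leb d)"
  shows "(\<integral>\<^sup>+ t. F t \<partial>leb d) = ennreal \<bar>Determinant.det A\<bar> * (\<integral>\<^sup>+ t. F (lin d A t) \<partial>leb d)"
proof -
  have "scales_by_det d A"
    by (rule scales_by_det_elimination[of A d 0]) (use assms in auto)
  with assms(3) show ?thesis unfolding scales_by_det_def by blast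
qed

lemma nn_integral_leb_translate:
  assumes [measurable]: "F \<in> borel_measurable (leb d)"
  shows "(\<integral>\<^sup>+ t. F t \<partial>leb d) = (\<integral>\<^sup>+ t. F (\<lambda>i\<in>{..<d}. t i + \<tau> i) \<partial>leb d)"
proof -
  define S where "S n t = (\<lambda>i\<in>{..<d}. t i + (if i < n then \<tau> i else 0))" for n :: nat and t :: "nat \<Rightarrow> real"
  have S: "(\<integral>\<^sup>+ t. F t \<partial>leb d) = (\<integral>\<^sup>+ t. F (S n t) \<partial>leb d)" if "n \<le> d" for n
    using that
  proof (induction n)
    case 0
    have "S 0 t = t" if "t \<in> space (leb d)" for t
      using that by (auto simp: S_def fun_eq_iff space_PiM PiE_def extensional_def)
    then show ?case by (auto intro!: nn_integral_cong)
  next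
    case (Suc n)
    have [measurable]: "S n \<in> measurable (leb d) (leb d)"
      unfolding S_def by measurable
    have upd: "S n (t(n := 1 * t n + \<tau> n)) = S (Suc n) t" for t
      using Suc.prems by (auto simp: S_def fun_eq_iff less_Suc_eq)
    have "(\<integral>\<^sup>+ t. F t \<partial>leb d) = (\<integral>\<^sup>+ t. F (S n t) \<partial>leb d)"
      by (rule Suc.IH) (use Suc.prems in simp)
    also have "\<dots> = ennreal \<bar>1\<bar> * (\<integral>\<^sup>+ t. F (S n (t(n := 1 * t n + \<tau> n))) \<partial>leb d)"
      by (rule nn_integral_leb_update) (use Suc.prems in auto)
    finally show ?case unfolding upd by (simp only: abs_one ennreal_1 mult_1)
  qed
  have "S d = (\<lambda>t. \<lambda>i\<in>{..<d}. t i + \<tau> i)" by (auto simp: S_def fun_eq_iff)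
  from S[OF order_refl] show ?thesis unfolding \<open>S d = _\<close> .
qed

section \<open>Lebesgue measure on an affine hull in affine charts\<close>

definition chart :: "'a::euclidean_space \<Rightarrow> 'a list \<Rightarrow> (nat \<Rightarrow> real) \<Rightarrow> 'a" where
  "chart a us t = a + (\<Sum>i<length us. t i *\<^sub>R us ! i)"

lemma measurable_chart [measurable]: "chart a us \<in> measurable (leb (length us)) borel"
  unfolding chart_def by measurable

text \<open>Ordered version of \<^const>\<open>orthonormal_basis_of\<close>: coordinates are then indexed by an initial segment of
  the naturals, as are the rows of \<^const>\<open>ray_matrix\<close>.\<close>

definition orthonormal_frame :: "'a::euclidean_space set \<Rightarrow> 'a list \<Rightarrow> bool" where
  "orthonormal_frame V bs \<longleftrightarrow> distinct bs \<and> orthonormal_basis_of V (set bs)"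

lemma sum_set_nth:
  assumes "distinct xs"
  shows "(\<Sum>x\<in>set xs. f x) = (\<Sum>i<length xs. f (xs ! i))"
  using sum.reindex_bij_betw[OF bij_betw_nth[OF assms refl refl], of f] by simp

lemma frame_inner:
  assumes "orthonormal_frame V bs" "i < length bs" "j < length bs"
  shows "bs ! i \<bullet> bs ! j = (if i = j then 1 else 0)"
proof (cases "i = j")
  case True
  have "norm (bs ! i) = 1"
    using assms unfolding orthonormal_frame_def orthonormal_basis_of_def by (metis nth_mem)
  then show ?thesis using True by (simp add: norm_eq_1)
next
  case False
  then have "bs ! i \<noteq> bs ! j" using assms by (auto simp: orthonormal_frame_def nth_eq_iff_index_eq)
  then show ?thesis
    using assms False unfolding orthonormal_frame_def orthonormal_basis_of_def pairwise_def
    by (metis nth_mem)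
qed

lemma frame_expansion:
  assumes "orthonormal_frame V bs" "x \<in> V"
  shows "x = (\<Sum>i<length bs. (bs ! i \<bullet> x) *\<^sub>R bs ! i)"
proof -
  have "x \<in> span (set bs)" using assms by (simp add: orthonormal_frame_def orthonormal_basis_of_def)
  then show ?thesis
  proof (induction rule: span_induct_alt)
    case base
    then show ?case by simp
  next
    case (step c b y)
    then obtain k where k: "k < length bs" "b = bs ! k" by (auto simp: in_set_conv_nth)
    have "(\<Sum>i<length bs. (bs ! i \<bullet> (c *\<^sub>R b + y)) *\<^sub>R bs ! i)
        = (\<Sum>i<length bs. (if i = k then c *\<^sub>R bs ! i else 0) + (bs ! i \<bullet> y) *\<^sub>R bs ! i)"
      using k by (intro sum.cong) (auto simp: inner_add_right frame_inner[OF assms(1)] algebra_simps)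
    also have "\<dots> = c *\<^sub>R b + y"
      using k step.IH[symmetric] by (simp add: sum.distrib)
    finally show ?case by simp
  qed
qed

lemma frame_span: "orthonormal_frame V bs \<Longrightarrow> subspace V \<and> set bs \<subseteq> V"
  by (auto simp: orthonormal_frame_def orthonormal_basis_of_def span_base)

lemma ray_matrix_carrier: "length bs = d \<Longrightarrow> length us = d \<Longrightarrow> ray_matrix bs us \<in> carrier_mat d d"
  by (simp add: ray_matrix_def)

lemma independent_list_coefficients:
  assumes us: "distinct us" "independent (set us)"
    and "(\<Sum>j<length us. t j *\<^sub>R us ! j) = 0" and k: "k < length us"
  shows "t k = 0"
proof -
  let ?d = "length us"
  define w where "w y = t (the_inv_into {..<?d} ((!) us) y)" for y
  have inj: "inj_on ((!) us) {..<?d}" using us(1) by (simp add: inj_on_nth)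
  have w: "w (us ! j) = t j" if "j < ?d" for j
    using that inj by (simp add: w_def the_inv_into_f_f)
  have "(\<Sum>y\<in>set us. w y *\<^sub>R y) = 0"
    using assms(3) by (simp add: sum_set_nth[OF us(1)] w)
  then have "w (us ! k) = 0"
    using independentD[OF us(2) _ _ , of "set us" w "us ! k"] k by simp
  then show ?thesis using w[OF k] by simp
qed

text \<open>A kernel vector of the matrix gives a linear combination of the \<open>us\<close> that lies in \<open>V\<close> and is
  orthogonal to a basis of \<open>V\<close>, hence vanishes.\<close>

lemma det_ray_matrix_nonzero:
  assumes bs: "orthonormal_frame V bs" and us: "distinct us" "independent (set us)" "set us \<subseteq> V"
    and len: "length us = length bs"
  shows "Determinant.det (ray_matrix bs us) \<noteq> 0"
proof
  let ?d = "length bs"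
  assume "Determinant.det (ray_matrix bs us) = 0"
  then obtain v where v: "v \<in> carrier_vec ?d" "v \<noteq> 0\<^sub>v ?d" "ray_matrix bs us *\<^sub>v v = 0\<^sub>v ?d"
    using det_0_iff_vec_prod_zero_field[OF ray_matrix_carrier[OF refl len]] by blast
  define x where "x = (\<Sum>j<?d. vec_index v j *\<^sub>R us ! j)"
  have "x \<in> V"
    unfolding x_def using us(3) len frame_span[OF bs]
    by (intro subspace_sum subspace_scale) (auto simp: subset_iff)
  moreover have "bs ! i \<bullet> x = 0" if "i < ?d" for i
  proof -
    have "bs ! i \<bullet> x = vec_index (ray_matrix bs us *\<^sub>v v) i"
      using that v(1) len
      by (auto simp: x_def inner_sum_right Matrix.scalar_prod_def ray_matrix_def atLeast0LessThan
          mult.commute intro!: sum.cong)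
    then show ?thesis using v(3) that by simp
  qed
  ultimately have "x = 0" using frame_expansion[OF bs, of x] by simp
  have "vec_index v k = 0" if k: "k < ?d" for k
    by (rule independent_list_coefficients[OF us(1,2)])
       (use \<open>x = 0\<close> k len in \<open>simp_all add: x_def\<close>)
  then have "v = 0\<^sub>v ?d" using v(1) by (intro eq_vecI) auto
  with v(2) show False by simp
qed

text \<open>In the coordinates of the frame, \<open>chart a' us\<close> is the matrix \<open>ray_matrix bs us\<close> followed by the
  translation \<open>\<tau>\<close>.\<close>

lemma distr_chart_change:
  assumes bs: "orthonormal_frame V bs" and us: "set us \<subseteq> V" "length us = length bs"
    and det: "Determinant.det (ray_matrix bs us) \<noteq> 0" and a': "a' - a \<in> V"
  shows "distr (leb (length bs)) borel (chart a bs) =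
    density (distr (leb (length us)) borel (chart a' us)) (\<lambda>_. ennreal \<bar>Determinant.det (ray_matrix bs us)\<bar>)"
    (is "?L = density ?R _")
proof (rule measure_eqI)
  fix X assume "X \<in> sets ?L"
  then have X [measurable]: "X \<in> sets borel" by simp
  let ?d = "length bs"
  define \<tau> where "\<tau> i = bs ! i \<bullet> (a' - a)" for i
  define F where "F t = (indicator X (chart a bs t) :: ennreal)" for t
  have F [measurable]: "F \<in> borel_measurable (leb ?d)" unfolding F_def by measurable
  have G [measurable]: "(\<lambda>t. F (\<lambda>i\<in>{..<?d}. t i + \<tau> i)) \<in> borel_measurable (leb ?d)"
    by measurable
  have coord: "chart a bs (\<lambda>i\<in>{..<?d}. lin ?d (ray_matrix bs us) t i + \<tau> i) = chart a' us t" for t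
  proof -
    let ?x = "a' - a + (\<Sum>j<?d. t j *\<^sub>R us ! j)"
    have "(\<Sum>j<?d. t j *\<^sub>R us ! j) \<in> V"
      using us frame_span[OF bs] by (intro subspace_sum subspace_scale) (auto simp: subset_iff)
    then have "?x \<in> V" using a' frame_span[OF bs] by (simp add: subspace_add)
    have "bs ! i \<bullet> ?x = lin ?d (ray_matrix bs us) t i + \<tau> i" if "i < ?d" for i
      using that us(2)
      by (auto simp: inner_add_right inner_sum_right \<tau>_def lin_def ray_matrix_def mult.commute intro!: sum.cong)
    then have "chart a bs (\<lambda>i\<in>{..<?d}. lin ?d (ray_matrix bs us) t i + \<tau> i)
        = a + (\<Sum>i<?d. (bs ! i \<bullet> ?x) *\<^sub>R bs ! i)"
      by (simp add: chart_def)
    also have "\<dots> = a + ?x" using frame_expansion[OF bs \<open>?x \<in> V\<close>] by simp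
    finally show ?thesis using us(2) by (simp add: chart_def)
  qed
  have "emeasure ?L X = (\<integral>\<^sup>+ t. F t \<partial>leb ?d)"
    by (simp add: F_def nn_integral_distr flip: nn_integral_indicator)
  also have "\<dots> = (\<integral>\<^sup>+ t. F (\<lambda>i\<in>{..<?d}. t i + \<tau> i) \<partial>leb ?d)"
    by (rule nn_integral_leb_translate[OF F])
  also have "\<dots> = ennreal \<bar>Determinant.det (ray_matrix bs us)\<bar>
      * (\<integral>\<^sup>+ t. F (\<lambda>i\<in>{..<?d}. lin ?d (ray_matrix bs us) t i + \<tau> i) \<partial>leb ?d)"
    by (rule nn_integral_leb_lin[OF ray_matrix_carrier[OF refl us(2)] det G])
  also have "(\<integral>\<^sup>+ t. F (\<lambda>i\<in>{..<?d}. lin ?d (ray_matrix bs us) t i + \<tau> i) \<partial>leb ?d)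
      = (\<integral>\<^sup>+ t. indicator X (chart a' us t) \<partial>leb (length us))"
    unfolding F_def coord by (simp add: us(2))
  also have "\<dots> = emeasure ?R X"
    by (simp add: nn_integral_distr flip: nn_integral_indicator)
  finally show "emeasure ?L X = emeasure (density ?R (\<lambda>_. ennreal \<bar>Determinant.det (ray_matrix bs us)\<bar>)) X"
    by (simp add: emeasure_density_const)
qed simp

text \<open>The matrix between two orthonormal bases is orthogonal.\<close>

lemma det_ray_matrix_frames:
  assumes "orthonormal_frame V bs" "orthonormal_frame V cs" and len: "length cs = length bs"
  shows "\<bar>Determinant.det (ray_matrix bs cs)\<bar> = 1"
proof -
  let ?d = "length bs" and ?R = "ray_matrix bs cs"
  have R: "?R \<in> carrier_mat ?d ?d" by (rule ray_matrix_carrier[OF refl len])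
  have "transpose_mat ?R * ?R = 1\<^sub>m ?d"
  proof (rule eq_matI)
    fix i j assume "i < dim_row (1\<^sub>m ?d)" "j < dim_col (1\<^sub>m ?d)"
    then have ij: "i < ?d" "j < ?d" by auto
    then have "cs ! j \<in> V" using frame_span[OF assms(2)] len by auto
    have "(transpose_mat ?R * ?R) $$ (i, j) = (\<Sum>k<?d. (bs ! k \<bullet> cs ! i) * (bs ! k \<bullet> cs ! j))"
      using ij len by (auto simp: Matrix.scalar_prod_def ray_matrix_def atLeast0LessThan intro!: sum.cong)
    also have "\<dots> = cs ! i \<bullet> (\<Sum>k<?d. (bs ! k \<bullet> cs ! j) *\<^sub>R bs ! k)"
      by (auto simp: inner_sum_right inner_commute mult.commute intro!: sum.cong)
    also have "\<dots> = cs ! i \<bullet> cs ! j"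
      using frame_expansion[OF assms(1) \<open>cs ! j \<in> V\<close>] by simp
    also have "\<dots> = 1\<^sub>m ?d $$ (i, j)"
      using ij len by (simp add: frame_inner[OF assms(2)])
    finally show "(transpose_mat ?R * ?R) $$ (i, j) = 1\<^sub>m ?d $$ (i, j)" .
  qed (use R in auto)
  then have "Determinant.det ?R * Determinant.det ?R = 1"
    using Determinant.det_mult[of "transpose_mat ?R" ?d ?R] R by (simp add: Determinant.det_transpose[OF R])
  then show ?thesis
    using abs_square_eq_1[of "Determinant.det ?R"] by (simp add: power2_eq_square)
qed

lemma distr_leb_nth:
  assumes "distinct bs"
  shows "distr (leb (length bs)) (Pi\<^sub>M (set bs) (\<lambda>_. lborel))
      (\<lambda>t. \<lambda>b\<in>set bs. t (the_inv_into {..<length bs} ((!) bs) b)) = Pi\<^sub>M (set bs) (\<lambda>_. lborel)"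
    (is "distr _ ?M ?\<phi> = _")
proof -
  interpret P: product_sigma_finite "\<lambda>_::'a. lborel :: real measure" ..
  interpret Q: product_sigma_finite "\<lambda>_::nat. lborel :: real measure" ..
  let ?d = "length bs"
  have inj: "inj_on ((!) bs) {..<?d}" using assms by (simp add: inj_on_nth)
  have inv: "the_inv_into {..<?d} ((!) bs) (bs ! i) = i" if "i < ?d" for i
    using inj that by (simp add: the_inv_into_f_f)
  have invset: "the_inv_into {..<?d} ((!) bs) b < ?d" if "b \<in> set bs" for b
    using that inv by (auto simp: in_set_conv_nth)
  have meas: "?\<phi> \<in> measurable (leb ?d) ?M"
  proof (rule measurable_restrict)
    fix b assume "b \<in> set bs"
    then show "(\<lambda>t. t (the_inv_into {..<?d} ((!) bs) b)) \<in> measurable (leb ?d) lborel"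
      using invset by (intro measurable_component_singleton) auto
  qed
  show ?thesis
  proof (rule P.PiM_eqI)
    fix A assume A: "\<And>b. b \<in> set bs \<Longrightarrow> A b \<in> sets (lborel :: real measure)"
    have "?\<phi> -` Pi\<^sub>E (set bs) A \<inter> space (leb ?d) = Pi\<^sub>E {..<?d} (\<lambda>i. A (bs ! i))"
    proof (intro equalityI subsetI)
      fix t assume "t \<in> ?\<phi> -` Pi\<^sub>E (set bs) A \<inter> space (leb ?d)"
      then have t: "t \<in> space (leb ?d)" "?\<phi> t \<in> Pi\<^sub>E (set bs) A" by auto
      show "t \<in> Pi\<^sub>E {..<?d} (\<lambda>i. A (bs ! i))"
      proof (rule PiE_I)
        fix i assume "i \<in> {..<?d}"
        then show "t i \<in> A (bs ! i)" using PiE_mem[OF t(2), of "bs ! i"] inv[of i] by simp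
      qed (use t(1) in \<open>auto simp: space_PiM PiE_def extensional_def\<close>)
    next
      fix t assume t: "t \<in> Pi\<^sub>E {..<?d} (\<lambda>i. A (bs ! i))"
      then have "t \<in> space (leb ?d)" by (auto simp: space_PiM PiE_def)
      moreover have "?\<phi> t \<in> Pi\<^sub>E (set bs) A"
      proof (rule PiE_I)
        fix b assume "b \<in> set bs"
        then obtain i where i: "i < ?d" "b = bs ! i" by (auto simp: in_set_conv_nth)
        then show "?\<phi> t b \<in> A b" using PiE_mem[OF t, of i] inv[of i] by simp
      qed simp
      ultimately show "t \<in> ?\<phi> -` Pi\<^sub>E (set bs) A \<inter> space (leb ?d)" by simp
    qed
    then have "emeasure (distr (leb ?d) ?M ?\<phi>) (Pi\<^sub>E (set bs) A) = emeasure (leb ?d) (Pi\<^sub>E {..<?d} (\<lambda>i. A (bs ! i)))"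
      using A by (subst emeasure_distr[OF meas]) (auto intro!: sets_PiM_I_finite)
    also have "\<dots> = (\<Prod>i<?d. emeasure lborel (A (bs ! i)))"
      using A by (intro Q.emeasure_PiM) auto
    also have "\<dots> = (\<Prod>b\<in>set bs. emeasure lborel (A b))"
      using prod.reindex_bij_betw[OF bij_betw_nth[OF assms refl refl], of "\<lambda>b. emeasure lborel (A b)"] by simp
    finally show "emeasure (distr (leb ?d) ?M ?\<phi>) (Pi\<^sub>E (set bs) A) = (\<Prod>b\<in>set bs. emeasure lborel (A b))" .
  qed auto
qed

lemma aff_direction_eq:
  assumes "a \<in> affine hull A"
  shows "aff_direction A = {x - a | x. x \<in> affine hull A}"
proof
  show "aff_direction A \<subseteq> {x - a | x. x \<in> affine hull A}"
  proof
    fix z assume "z \<in> aff_direction A"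
    then obtain x y where z: "z = x - y" "x \<in> affine hull A" "y \<in> affine hull A"
      by (auto simp: aff_direction_def)
    then have "a + 1 *\<^sub>R (x - y) \<in> affine hull A"
      using mem_affine_3_minus[OF affine_affine_hull assms z(2,3), of 1] by simp
    then show "z \<in> {x - a | x. x \<in> affine hull A}"
      using z(1) by (auto intro!: exI[of _ "a + (x - y)"])
  qed
qed (use assms in \<open>auto simp: aff_direction_def\<close>)

lemma ex_orthonormal_frame:
  assumes "subspace V"
  obtains bs where "orthonormal_frame V bs" "length bs = dim V"
proof -
  obtain B where B: "B \<subseteq> V" "pairwise real_inner_class.orthogonal B" "\<And>x. x \<in> B \<Longrightarrow> norm x = 1"
    "independent B" "card B = dim V" "span B = V"
    using orthonormal_basis_subspace[OF assms] by blast
  from finiteI_independent[OF B(4)] obtain bs where bs: "set bs = B" "distinct bs"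
    using finite_distinct_list by blast
  have "orthonormal_frame V bs"
    using B(2,3,6) bs by (auto simp: pairwise_def orthonormal_frame_def orthonormal_basis_of_def real_inner_class.orthogonal_def)
  moreover have "length bs = dim V" using B bs distinct_card[of bs] by simp
  ultimately show ?thesis using that by blast
qed

lemma length_frame:
  assumes "orthonormal_frame V bs"
  shows "length bs = dim V"
proof -
  have B: "pairwise real_inner_class.orthogonal (set bs)" "0 \<notin> set bs" "span (set bs) = V"
    using assms by (auto simp: orthonormal_frame_def orthonormal_basis_of_def pairwise_def real_inner_class.orthogonal_def)
  then have "independent (set bs)" by (intro pairwise_orthogonal_independent) auto
  then have "card (set bs) = dim V" using dim_span_eq_card_independent[of "set bs"] B(3) by simp
  then show ?thesis using assms by (simp add: orthonormal_frame_def distinct_card)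
qed

text \<open>The measure on an affine hull is computed in whatever basis of its direction space suits the set to
  be measured, at the price of a Jacobian. Comparing two orthonormal frames first removes the
  dependence on the basis and the origin that the definition picks by choice.\<close>

lemma aff_lebesgue_chart:
  assumes a: "a \<in> affine hull A" and bs: "orthonormal_frame (aff_direction A) bs"
    and us: "distinct us" "independent (set us)" "span (set us) = aff_direction A"
  shows "aff_lebesgue A = density (distr (leb (length us)) borel (chart a us))
      (\<lambda>_. ennreal \<bar>Determinant.det (ray_matrix bs us)\<bar>)"
    and "0 < \<bar>Determinant.det (ray_matrix bs us)\<bar>"
proof -
  let ?V = "aff_direction A"
  define B where "B = (SOME B. orthonormal_basis_of ?V B)"
  define a0 where "a0 = (SOME a. a \<in> affine hull A)"
  have B: "orthonormal_basis_of ?V B"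
    unfolding B_def by (rule someI_ex) (use bs in \<open>auto simp: orthonormal_frame_def\<close>)
  have a0: "a0 \<in> affine hull A" unfolding a0_def by (rule someI_ex) (use a in blast)
  have "pairwise real_inner_class.orthogonal B" "0 \<notin> B"
    using B by (auto simp: orthonormal_basis_of_def pairwise_def real_inner_class.orthogonal_def)
  then have "finite B" by (intro finiteI_independent pairwise_orthogonal_independent)
  then obtain cs where cs: "set cs = B" "distinct cs" using finite_distinct_list by blast
  then have cs': "orthonormal_frame ?V cs" using B by (simp add: orthonormal_frame_def)
  have len: "length bs = dim ?V" "length cs = dim ?V" by (rule length_frame; fact)+
  have "length us = card (set us)" using us(1) by (simp add: distinct_card)
  also have "\<dots> = dim ?V" using us(2,3) dim_span_eq_card_independent[of "set us"] by simp
  finally have lu: "length us = dim ?V" .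
  have us': "set us \<subseteq> ?V" using us(3) span_superset[of "set us"] by simp
  have diff: "x - y \<in> ?V" if "x \<in> affine hull A" "y \<in> affine hull A" for x y
    using that by (auto simp: aff_direction_def)
  let ?idx = "\<lambda>b. the_inv_into {..<length cs} ((!) cs) b"
  have inv: "?idx (cs ! i) = i" if "i < length cs" for i
    using cs(2) that by (simp add: the_inv_into_f_f inj_on_nth)
  have [measurable]: "(\<lambda>t. \<lambda>b\<in>set cs. t (?idx b)) \<in> measurable (leb (length cs)) (Pi\<^sub>M (set cs) (\<lambda>_. lborel))"
  proof (rule measurable_restrict)
    fix b assume "b \<in> set cs"
    then show "(\<lambda>t. t (?idx b)) \<in> measurable (leb (length cs)) lborel"
      using inv by (intro measurable_component_singleton) (auto simp: in_set_conv_nth)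
  qed
  have "aff_lebesgue A = distr (Pi\<^sub>M B (\<lambda>_. lborel)) borel (\<lambda>t. a0 + (\<Sum>b\<in>B. t b *\<^sub>R b))"
    by (simp add: aff_lebesgue_def Let_def B_def a0_def)
  also have "\<dots> = distr (distr (leb (length cs)) (Pi\<^sub>M (set cs) (\<lambda>_. lborel)) (\<lambda>t. \<lambda>b\<in>set cs. t (?idx b)))
      borel (\<lambda>t. a0 + (\<Sum>b\<in>set cs. t b *\<^sub>R b))"
    by (subst distr_leb_nth[OF cs(2)]) (simp only: cs(1))
  also have "\<dots> = distr (leb (length cs)) borel
      ((\<lambda>t. a0 + (\<Sum>b\<in>set cs. t b *\<^sub>R b)) \<circ> (\<lambda>t. \<lambda>b\<in>set cs. t (?idx b)))"
    by (rule distr_distr) measurable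
  also have "\<dots> = distr (leb (length cs)) borel (chart a0 cs)"
    by (rule arg_cong[where f = "distr (leb (length cs)) borel"])
       (auto simp: fun_eq_iff chart_def sum_set_nth[OF cs(2)] inv intro!: sum.cong)
  finally have 1: "aff_lebesgue A = distr (leb (length cs)) borel (chart a0 cs)" .
  have d1: "\<bar>Determinant.det (ray_matrix cs bs)\<bar> = 1"
    by (rule det_ray_matrix_frames[OF cs' bs]) (simp add: len)
  have "distr (leb (length cs)) borel (chart a0 cs) = density (distr (leb (length bs)) borel (chart a bs))
      (\<lambda>_. ennreal \<bar>Determinant.det (ray_matrix cs bs)\<bar>)"
    by (rule distr_chart_change[OF cs' _ _ _ diff[OF a a0]]) (use frame_span[OF bs] len d1 in auto)
  then have 2: "distr (leb (length cs)) borel (chart a0 cs) = distr (leb (length bs)) borel (chart a bs)"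
    by (simp only: d1 ennreal_1 density_1)
  show "0 < \<bar>Determinant.det (ray_matrix bs us)\<bar>"
    using det_ray_matrix_nonzero[OF bs us(1,2) us'] len lu by simp
  then show "aff_lebesgue A = density (distr (leb (length us)) borel (chart a us))
      (\<lambda>_. ennreal \<bar>Determinant.det (ray_matrix bs us)\<bar>)"
    unfolding 1 2 by (intro distr_chart_change[OF bs us' _ _ diff[OF a a]]) (use len lu in auto)
qed

lemma aff_lebesgue_cong:
  assumes "S \<subseteq> Q" "S \<noteq> {}" "aff_dim S = aff_dim Q"
  shows "aff_lebesgue S = aff_lebesgue Q"
proof -
  have "affine hull S = affine hull Q"
    by (rule affine_dim_equal) (use assms hull_mono[OF assms(1), of affine] in auto)
  then show ?thesis by (simp add: aff_lebesgue_def aff_direction_def)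
qed

section \<open>Conditional means and integrals through charts\<close>

lemma borel_rel_interior: "rel_interior (S :: 'a::euclidean_space set) \<in> sets borel"
proof -
  have "openin (top_of_set (affine hull S)) (rel_interior S)" by (rule openin_rel_interior)
  then obtain T where "open T" "rel_interior S = affine hull S \<inter> T" by (auto simp: openin_open)
  moreover have "closed (affine hull S)" by (rule closed_affine_hull)
  ultimately show ?thesis by auto
qed

text \<open>Both cases of the theorem are laws with a density on an affine hull, and neither quantity
  sees the relative boundary once it is null. The formula for the conditional mean holds for
  probability zero as well, since division by zero yields zero.\<close>

lemma check_density:
  fixes c :: "'w \<Rightarrow> 'a::euclidean_space"
  assumes "prob_space M" and c [measurable]: "c \<in> borel_measurable M"
    and law: "distr M borel c = density \<mu> (\<lambda>x. ennreal (h x))"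
    and sets [measurable_cong]: "sets \<mu> = sets borel"
    and h [measurable]: "h \<in> borel_measurable borel" and h0: "\<And>x. 0 \<le> h x"
    and S [measurable]: "S \<in> sets borel" and AE: "AE x in \<mu>. x \<in> S \<longrightarrow> x \<in> rel_interior S"
  shows "check_p M c S = (\<integral>x. indicator S x * h x \<partial>\<mu>)"
    and "check_c M c S = (1 / check_p M c S) *\<^sub>R (\<integral>x. (indicator S x * h x) *\<^sub>R x \<partial>\<mu>)"
proof -
  interpret prob_space M by fact
  note [measurable] = borel_rel_interior
  let ?E = "ri_event M c S" and ?p = "check_p M c S"
  have E: "?E = c -` rel_interior S \<inter> space M" by (auto simp: ri_event_def)
  have E_sets [measurable]: "?E \<in> sets M" unfolding E by measurable
  have ae: "AE x in \<mu>. indicator (rel_interior S) x = (indicator S x :: real)"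
    using AE rel_interior_subset[of S] by (auto elim!: eventually_mono simp: indicator_def)
  have "?p = measure (distr M borel c) (rel_interior S)"
    unfolding check_p_def E by (rule measure_distr[symmetric]) measurable
  also have "\<dots> = enn2real (\<integral>\<^sup>+x. ennreal (indicator (rel_interior S) x * h x) \<partial>\<mu>)"
    unfolding law measure_def
    by (subst emeasure_density) (auto simp: h0 ennreal_mult'' ennreal_indicator mult.commute)
  also have "\<dots> = (\<integral>x. indicator (rel_interior S) x * h x \<partial>\<mu>)"
    by (rule integral_eq_nn_integral[symmetric]) (auto simp: h0)
  also have "\<dots> = (\<integral>x. indicator S x * h x \<partial>\<mu>)"
    by (rule integral_cong_AE) (use ae in \<open>auto elim!: eventually_mono\<close>)
  finally show "?p = (\<integral>x. indicator S x * h x \<partial>\<mu>)" .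
  show "check_c M c S = (1 / ?p) *\<^sub>R (\<integral>x. (indicator S x * h x) *\<^sub>R x \<partial>\<mu>)"
  proof (cases "?p > 0")
    case True
    have em: "emeasure M ?E = ennreal ?p" by (simp add: check_p_def emeasure_eq_measure)
    have "check_c M c S = (\<integral>\<omega>. c \<omega> \<partial>density M (\<lambda>\<omega>. ennreal (indicator ?E \<omega> / ?p)))"
      using True by (simp add: check_c_def uniform_measure_def em divide_ennreal[symmetric] ennreal_indicator)
    also have "\<dots> = (\<integral>\<omega>. (indicator ?E \<omega> / ?p) *\<^sub>R c \<omega> \<partial>M)"
      using True by (intro integral_density) auto
    also have "\<dots> = (\<integral>\<omega>. (1 / ?p) *\<^sub>R (indicator (rel_interior S) (c \<omega>) *\<^sub>R c \<omega>) \<partial>M)"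
      by (intro Bochner_Integration.integral_cong refl) (auto simp: ri_event_def indicator_def)
    also have "\<dots> = (1 / ?p) *\<^sub>R (\<integral>\<omega>. indicator (rel_interior S) (c \<omega>) *\<^sub>R c \<omega> \<partial>M)"
      by (rule integral_scaleR_right)
    also have "(\<integral>\<omega>. indicator (rel_interior S) (c \<omega>) *\<^sub>R c \<omega> \<partial>M)
        = (\<integral>x. indicator (rel_interior S) x *\<^sub>R x \<partial>distr M borel c)"
      by (subst integral_distr) auto
    also have "\<dots> = (\<integral>x. h x *\<^sub>R (indicator (rel_interior S) x *\<^sub>R x) \<partial>\<mu>)"
      unfolding law by (rule integral_density) (auto simp: h0)
    also have "\<dots> = (\<integral>x. (indicator S x * h x) *\<^sub>R x \<partial>\<mu>)"
      by (rule integral_cong_AE) (use ae in \<open>auto elim!: eventually_mono\<close>)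
    finally show ?thesis .
  next
    case False
    then have "?p = 0" unfolding check_p_def using measure_nonneg[of M ?E] by linarith
    then show ?thesis by (simp add: check_c_def)
  qed
qed

lemma integral_chart:
  fixes f :: "'a::euclidean_space \<Rightarrow> 'b::{banach, second_countable_topology}"
  assumes "\<mu> = density (distr (leb (length us)) borel (chart a us)) (\<lambda>_. ennreal D)" "0 \<le> D"
    and [measurable]: "f \<in> borel_measurable borel"
  shows "(\<integral>x. f x \<partial>\<mu>) = D *\<^sub>R (\<integral>t. f (chart a us t) \<partial>leb (length us))"
  using assms(2) unfolding assms(1)
  by (subst integral_density) (auto simp: integral_distr)

lemma nn_integral_chart:
  assumes "\<mu> = density (distr (leb (length us)) borel (chart a us)) (\<lambda>_. ennreal D)"
    and [measurable]: "f \<in> borel_measurable borel"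
  shows "(\<integral>\<^sup>+x. f x \<partial>\<mu>) = ennreal D * (\<integral>\<^sup>+t. f (chart a us t) \<partial>leb (length us))"
  unfolding assms(1)
  by (subst nn_integral_density) (auto simp: nn_integral_distr nn_integral_cmult)

lemma AE_chart:
  assumes "\<mu> = density (distr (leb (length us)) borel (chart a us)) (\<lambda>_. ennreal D)"
    and "{x. P x} \<in> sets borel" "AE t in leb (length us). P (chart a us t)"
  shows "AE x in \<mu>. P x"
  unfolding assms(1) using assms(2,3) by (auto simp: AE_density AE_distr_iff)

text \<open>Coordinate hyperplanes are null; facets of simplices and of simplicial cones correspond to these.\<close>

lemma AE_leb_coordinate:
  assumes "i < d"
  shows "AE t in leb d. t i \<noteq> 0"
proof (rule AE_I)
  interpret product_sigma_finite "\<lambda>_::nat. lborel :: real measure" ..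
  let ?N = "Pi\<^sub>E {..<d} (\<lambda>j. if j = i then {0} else UNIV :: real set)"
  show "{t \<in> space (leb d). \<not> t i \<noteq> 0} \<subseteq> ?N"
    by (auto simp: space_PiM PiE_def Pi_def)
  have "emeasure (leb d) ?N = (\<Prod>j<d. emeasure lborel (if j = i then {0} else UNIV :: real set))"
    by (rule emeasure_PiM) auto
  also have "\<dots> = 0" using assms by (intro prod_zero) auto
  finally show "emeasure (leb d) ?N = 0" .
  show "?N \<in> sets (leb d)" by (rule sets_PiM_I_finite) auto
qed

lemma has_bochner_integral_power_exp:
  assumes l: "(0::real) < l"
  shows "has_bochner_integral lborel (\<lambda>x. indicator {0..} x * (x ^ k * exp (- l * x))) (fact k / l ^ Suc k)"
proof (rule has_bochner_integral_nn_integral)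
  define f where "f x = ennreal (x ^ k * exp (- x)) * indicator {0..} x" for x :: real
  have "ennreal (fact k) = (\<integral>\<^sup>+x. f x \<partial>lborel)"
    unfolding f_def using nn_intergal_power_times_exp_Ici[of k] by (simp add: ennreal_of_nat_eq_real_of_nat)
  also have "\<dots> = ennreal \<bar>l\<bar> * (\<integral>\<^sup>+x. f (0 + l * x) \<partial>lborel)"
    by (rule nn_integral_real_affine) (use l in \<open>auto simp: f_def\<close>)
  also have "(\<integral>\<^sup>+x. f (0 + l * x) \<partial>lborel)
      = (\<integral>\<^sup>+x. ennreal (l ^ k) * ennreal (indicator {0..} x * (x ^ k * exp (- l * x))) \<partial>lborel)"
    using l by (intro nn_integral_cong)
      (auto simp: f_def indicator_def zero_le_mult_iff power_mult_distrib mult.assoc simp flip: ennreal_mult)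
  also have "\<dots> = ennreal (l ^ k) * (\<integral>\<^sup>+x. ennreal (indicator {0..} x * (x ^ k * exp (- l * x))) \<partial>lborel)"
    by (rule nn_integral_cmult) measurable
  finally have "ennreal (fact k) = ennreal (l ^ Suc k)
      * (\<integral>\<^sup>+x. ennreal (indicator {0..} x * (x ^ k * exp (- l * x))) \<partial>lborel)"
    using l by (simp add: ennreal_mult mult.assoc)
  then have "ennreal (1 / l ^ Suc k) * ennreal (fact k) = (ennreal (1 / l ^ Suc k) * ennreal (l ^ Suc k))
      * (\<integral>\<^sup>+x. ennreal (indicator {0..} x * (x ^ k * exp (- l * x))) \<partial>lborel)"
    by (simp add: mult.assoc)
  moreover have "ennreal (1 / l ^ Suc k) * ennreal (l ^ Suc k) = 1"
    using l by (simp flip: ennreal_mult)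
  ultimately show "(\<integral>\<^sup>+x. ennreal (indicator {0..} x * (x ^ k * exp (- l * x))) \<partial>lborel) = ennreal (fact k / l ^ Suc k)"
    using l by (simp flip: ennreal_mult)
qed (use l in \<open>auto simp: indicator_def\<close>)

section \<open>Simplices\<close>

text \<open>The barycentric coordinate belonging to the base vertex.\<close>

definition slack :: "nat \<Rightarrow> (nat \<Rightarrow> real) \<Rightarrow> real" where
  "slack d t = 1 - (\<Sum>i<d. t i)"

text \<open>The preimage of a simplex under its chart.\<close>

definition corner :: "nat \<Rightarrow> (nat \<Rightarrow> real) set" where
  "corner d = {t. (\<forall>i<d. 0 \<le> t i) \<and> 0 \<le> slack d t}"

lemma measurable_slack [measurable]: "slack d \<in> borel_measurable (leb d)"
  unfolding slack_def by measurable

lemma measurable_indicator_corner [measurable]: "(\<lambda>t. indicator (corner d) t :: real) \<in> borel_measurable (leb d)"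
proof -
  have "indicator (corner d) t = (\<Prod>i<d. indicator {0..} (t i)) * (indicator {0..} (slack d t) :: real)" for t
    by (auto simp: corner_def indicator_def prod_zero_iff)
  then show ?thesis by simp
qed

text \<open>Exchanging the base vertex with another vertex of the simplex reflects a single coordinate
  about a center depending on the other coordinates, so it preserves the measure.\<close>

lemma nn_integral_leb_swap_slack:
  assumes k: "k < d" and [measurable]: "F \<in> borel_measurable (leb d)"
  shows "(\<integral>\<^sup>+ t. F t \<partial>leb d) = (\<integral>\<^sup>+ t. F (t(k := slack d t)) \<partial>leb d)"
proof -
  define g where "g t = 1 - (\<Sum>j\<in>{..<d} - {k}. t j)" for t :: "nat \<Rightarrow> real"
  have [measurable]: "g \<in> borel_measurable (leb d)" unfolding g_def by measurable
  have upd: "t(k := (-1) * t k + g t) = t(k := slack d t)" for t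
    using k by (simp add: g_def slack_def sum.remove[of "{..<d}" k] algebra_simps)
  have "(\<integral>\<^sup>+ t. F t \<partial>leb d) = ennreal \<bar>-1\<bar> * (\<integral>\<^sup>+ t. F (t(k := (-1) * t k + g t)) \<partial>leb d)"
    by (rule nn_integral_leb_update[OF k]) (auto simp: g_def intro!: sum.cong)
  then show ?thesis unfolding upd by (simp only: abs_minus_cancel abs_one ennreal_1 mult_1)
qed

lemma slack_swap: "k < d \<Longrightarrow> slack d (t(k := slack d t)) = t k"
  by (simp add: slack_def sum.remove[of "{..<d}" k])

lemma corner_swap: "k < d \<Longrightarrow> t(k := slack d t) \<in> corner d \<longleftrightarrow> t \<in> corner d"
  unfolding corner_def mem_Collect_eq slack_swap by (auto simp: fun_upd_def)

lemma corner_moment_swap: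
  assumes k: "k < d"
  shows "(\<integral>t. indicator (corner d) t * t k \<partial>leb d) = (\<integral>t. indicator (corner d) t * slack d t \<partial>leb d)"
proof -
  have [measurable]: "(\<lambda>t. t k) \<in> borel_measurable (leb d)"
    using measurable_component_singleton[of k "{..<d}" "\<lambda>_. lborel :: real measure"] k by simp
  have "(\<integral>t. indicator (corner d) t * slack d t \<partial>leb d)
      = enn2real (\<integral>\<^sup>+t. ennreal (indicator (corner d) t * slack d t) \<partial>leb d)"
    by (rule integral_eq_nn_integral) (auto simp: corner_def indicator_def)
  also have "(\<integral>\<^sup>+t. ennreal (indicator (corner d) t * slack d t) \<partial>leb d)
      = (\<integral>\<^sup>+t. ennreal (indicator (corner d) (t(k := slack d t)) * slack d (t(k := slack d t))) \<partial>leb d)"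
    by (rule nn_integral_leb_swap_slack[OF k]) measurable
  also have "\<dots> = (\<integral>\<^sup>+t. ennreal (indicator (corner d) t * t k) \<partial>leb d)"
    by (simp add: slack_swap[OF k] corner_swap[OF k] indicator_def)
  also have "enn2real \<dots> = (\<integral>t. indicator (corner d) t * t k \<partial>leb d)"
    by (rule integral_eq_nn_integral[symmetric]) (use k in \<open>auto simp: corner_def indicator_def\<close>)
  finally show ?thesis ..
qed

lemma integrable_indicator_box:
  "integrable (leb d) (\<lambda>t. indicator (Pi\<^sub>E {..<d} (\<lambda>_. {0..b})) t :: real)"
  and integral_indicator_box:
  "0 \<le> b \<Longrightarrow> (\<integral>t. indicator (Pi\<^sub>E {..<d} (\<lambda>_. {0..b})) t \<partial>leb d) = b ^ d"
proof -
  interpret product_sigma_finite "\<lambda>_::nat. lborel :: real measure" ..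
  have sets: "Pi\<^sub>E {..<d} (\<lambda>_. {0..b}) \<in> sets (leb d)" by (rule sets_PiM_I_finite) auto
  have em: "emeasure (leb d) (Pi\<^sub>E {..<d} (\<lambda>_. {0..b})) = (\<Prod>j<d. emeasure lborel {0..b})"
    by (rule emeasure_PiM) auto
  also have "\<dots> = ennreal (max 0 b) ^ d"
    by (simp add: emeasure_lborel_Icc_eq max_def)
  also have "\<dots> = ennreal (max 0 b ^ d)" by (rule ennreal_power) simp
  also have "\<dots> < \<infinity>" unfolding infinity_ennreal_def by (rule ennreal_less_top)
  finally show "integrable (leb d) (\<lambda>t. indicator (Pi\<^sub>E {..<d} (\<lambda>_. {0..b})) t :: real)"
    using sets by (intro integrable_real_indicator) auto
  assume b: "0 \<le> b"
  then have "emeasure (leb d) (Pi\<^sub>E {..<d} (\<lambda>_. {0..b})) = ennreal (b ^ d)"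
    using em by (simp add: ennreal_power)
  then show "(\<integral>t. indicator (Pi\<^sub>E {..<d} (\<lambda>_. {0..b})) t \<partial>leb d) = b ^ d"
    using sets b by (simp add: measure_def Int_absorb2 sets.sets_into_space)
qed

lemma corner_le_1:
  assumes "t \<in> corner d" "i < d"
  shows "t i \<le> 1"
proof -
  have "t i \<le> (\<Sum>j<d. t j)" using assms by (intro member_le_sum) (auto simp: corner_def)
  then show ?thesis using assms by (simp add: corner_def slack_def)
qed

lemma integrable_corner_bounded:
  fixes f :: "(nat \<Rightarrow> real) \<Rightarrow> real"
  assumes [measurable]: "f \<in> borel_measurable (leb d)"
    and bound: "\<And>t. t \<in> corner d \<Longrightarrow> \<bar>f t\<bar> \<le> 1"
  shows "integrable (leb d) (\<lambda>t. indicator (corner d) t * f t)"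
proof (rule Bochner_Integration.integrable_bound[OF integrable_indicator_box[of d 1]])
  show "AE t in leb d. norm (indicator (corner d) t * f t)
      \<le> norm (indicator (Pi\<^sub>E {..<d} (\<lambda>_. {0..1})) t :: real)"
  proof (rule AE_I2)
    fix t assume "t \<in> space (leb d)"
    then show "norm (indicator (corner d) t * f t) \<le> norm (indicator (Pi\<^sub>E {..<d} (\<lambda>_. {0..1})) t :: real)"
      using bound[of t] corner_le_1[of t d]
      by (cases "t \<in> corner d") (auto simp: indicator_def corner_def space_PiM PiE_def Pi_def)
  qed
qed measurable

text \<open>By the exchange symmetry all \<open>d + 1\<close> barycentric coordinates have the same mean, and they add up
  to one. A small cube inside the corner shows that its volume is positive.\<close>

lemma corner_moments:
  shows "0 < (\<integral>t. indicator (corner d) t \<partial>leb d :: real)"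
    and "integrable (leb d) (\<lambda>t. indicator (corner d) t :: real)"
    and "k < d \<Longrightarrow> integrable (leb d) (\<lambda>t. indicator (corner d) t * t k)"
    and "k < d \<Longrightarrow> (\<integral>t. indicator (corner d) t * t k \<partial>leb d)
      = (\<integral>t. indicator (corner d) t \<partial>leb d) / (real d + 1)"
proof -
  show int1: "integrable (leb d) (\<lambda>t. indicator (corner d) t :: real)"
    using integrable_corner_bounded[of "\<lambda>_. 1" d] by simp
  have intk: "integrable (leb d) (\<lambda>t. indicator (corner d) t * t k)" if "k < d" for k
  proof -
    have [measurable]: "(\<lambda>t. t k) \<in> borel_measurable (leb d)"
      using measurable_component_singleton[of k "{..<d}" "\<lambda>_. lborel :: real measure"] that by simp
    show ?thesis
      using that corner_le_1[of _ d k] by (intro integrable_corner_bounded) (auto simp: corner_def)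
  qed
  then show "k < d \<Longrightarrow> integrable (leb d) (\<lambda>t. indicator (corner d) t * t k)" .
  have int0: "integrable (leb d) (\<lambda>t. indicator (corner d) t * slack d t)"
  proof (rule integrable_corner_bounded)
    fix t assume "t \<in> corner d"
    then show "\<bar>slack d t\<bar> \<le> 1" by (auto simp: corner_def slack_def intro!: sum_nonneg)
  qed measurable
  let ?J = "\<integral>t. indicator (corner d) t * slack d t \<partial>leb d"
  have Jk: "(\<integral>t. indicator (corner d) t * t k \<partial>leb d) = ?J" if "k < d" for k
    by (rule corner_moment_swap[OF that])
  have "(\<integral>t. indicator (corner d) t \<partial>leb d)
      = (\<integral>t. indicator (corner d) t * slack d t + (\<Sum>k<d. indicator (corner d) t * t k) \<partial>leb d)"
  proof (intro Bochner_Integration.integral_cong refl)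
    show "indicator (corner d) t = indicator (corner d) t * slack d t + (\<Sum>k<d. indicator (corner d) t * t k)" for t
      by (cases "t \<in> corner d") (auto simp: slack_def)
  qed
  also have "\<dots> = ?J + (\<Sum>k<d. \<integral>t. indicator (corner d) t * t k \<partial>leb d)"
  proof -
    have "(\<integral>t. (\<Sum>k<d. indicator (corner d) t * t k) \<partial>leb d) = (\<Sum>k<d. \<integral>t. indicator (corner d) t * t k \<partial>leb d)"
      by (rule Bochner_Integration.integral_sum) (use intk in auto)
    moreover have "integrable (leb d) (\<lambda>t. \<Sum>k<d. indicator (corner d) t * t k)"
      by (rule Bochner_Integration.integrable_sum) (use intk in auto)
    ultimately show ?thesis by (simp only: Bochner_Integration.integral_add[OF int0])
  qed
  also have "(\<Sum>k<d. \<integral>t. indicator (corner d) t * t k \<partial>leb d) = (\<Sum>k<d. ?J)"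
    by (intro sum.cong refl Jk) simp
  also have "?J + (\<Sum>k<d. ?J) = (real d + 1) * ?J" by (simp add: distrib_right)
  finally have "?J = (\<integral>t. indicator (corner d) t \<partial>leb d) / (real d + 1)" by simp
  with Jk show "k < d \<Longrightarrow> (\<integral>t. indicator (corner d) t * t k \<partial>leb d)
      = (\<integral>t. indicator (corner d) t \<partial>leb d) / (real d + 1)" by simp
  let ?b = "1 / (real d + 1)"
  have "0 < ?b ^ d" by simp
  also have "\<dots> = (\<integral>t. indicator (Pi\<^sub>E {..<d} (\<lambda>_. {0..?b})) t \<partial>leb d)"
    by (rule integral_indicator_box[symmetric]) simp
  also have "\<dots> \<le> (\<integral>t. indicator (corner d) t \<partial>leb d)"
  proof (rule integral_mono[OF integrable_indicator_box int1])
    fix t :: "nat \<Rightarrow> real"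
    have "t \<in> corner d" if t: "t \<in> Pi\<^sub>E {..<d} (\<lambda>_. {0..?b})"
    proof -
      have "(\<Sum>i<d. t i) \<le> (\<Sum>i<d. ?b)" using t by (intro sum_mono) (auto simp: PiE_def Pi_def)
      also have "\<dots> \<le> 1" by (simp add: field_simps)
      finally show ?thesis using t by (auto simp: corner_def slack_def PiE_def Pi_def)
    qed
    then show "indicator (Pi\<^sub>E {..<d} (\<lambda>_. {0..?b})) t \<le> (indicator (corner d) t :: real)"
      by (auto simp: indicator_def)
  qed
  finally show "0 < (\<integral>t. indicator (corner d) t \<partial>leb d :: real)" .
qed

lemma AE_leb_slack: "AE t in leb d. slack d t \<noteq> 0"
proof (cases "d = 0")
  case True
  then show ?thesis by (simp add: slack_def)
next
  case False
  then have d: "0 < d" by simp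
  have "(\<integral>\<^sup>+t. indicator {0} (slack d t) \<partial>leb d) = (\<integral>\<^sup>+t. indicator {0} (slack d (t(0 := slack d t))) \<partial>leb d)"
    by (rule nn_integral_leb_swap_slack[OF d]) measurable
  also have "\<dots> = (\<integral>\<^sup>+t. 0 \<partial>leb d)"
    unfolding slack_swap[OF d]
    by (rule nn_integral_cong_AE) (use AE_leb_coordinate[OF d] in \<open>auto elim!: eventually_mono\<close>)
  finally have "(\<integral>\<^sup>+t. indicator {0} (slack d t) \<partial>leb d) = 0" by simp
  moreover have "(\<lambda>t. indicator {0} (slack d t) :: ennreal) \<in> borel_measurable (leb d)"
    by measurable
  ultimately have "AE t in leb d. indicator {0} (slack d t) = (0 :: ennreal)"
    by (simp only: nn_integral_0_iff_AE)
  then show ?thesis by (auto elim!: eventually_mono simp: indicator_def split: if_splits)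
qed

text \<open>Barycentric coordinates: \<open>w t\<close> assigns to each vertex its coordinate at the point with chart
  parameters \<open>t\<close>, and affine independence makes these unique.\<close>

lemma simplex_chart:
  fixes C :: "'a::euclidean_space set"
  assumes C: "\<not> affine_dependent C" "card C = Suc d" and S: "S = convex hull C"
  obtains us D v0 where "length us = d" "0 < D"
    and "aff_lebesgue S = density (distr (leb (length us)) borel (chart v0 us)) (\<lambda>_. ennreal D)"
    and "\<And>t. chart v0 us t \<in> S \<longleftrightarrow> t \<in> corner d"
    and "\<forall>t. 0 < slack d t \<and> (\<forall>i<d. 0 < t i) \<longrightarrow> chart v0 us t \<in> rel_interior S"
    and "(\<Sum>v\<in>C. v) = (real d + 1) *\<^sub>R v0 + (\<Sum>i<d. us ! i)"
proof -
  have fin: "finite C" using C(1) by (rule aff_independent_finite)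
  obtain v0 where v0: "v0 \<in> C" using C(2) by fastforce
  obtain vs where vs: "set vs = C - {v0}" "distinct vs"
    using finite_distinct_list[of "C - {v0}"] fin by auto
  have len: "length vs = d" using distinct_card[OF vs(2)] vs(1) C(2) v0 fin by simp
  have vs_C: "vs ! i \<in> C" "vs ! i \<noteq> v0" if "i < d" for i
    using that vs(1) len nth_mem[of i vs] by auto
  define us where "us = map (\<lambda>v. v - v0) vs"
  have lu: "length us = d" by (simp add: us_def len)
  have set_us: "set us = (\<lambda>x. - v0 + x) ` (C - {v0})" by (simp add: us_def vs(1))
  have us: "distinct us" using vs(2) by (simp add: us_def distinct_map inj_on_def)
  have ind: "independent (set us)"
    using C(1) affine_dependent_iff_dependent2[OF v0] by (simp add: set_us)
  have aff: "affine hull S = affine hull C" by (simp add: S affine_hull_convex_hull)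
  have v0S: "v0 \<in> affine hull S" using v0 by (simp add: aff hull_inc)
  have spn: "span (set us) = aff_direction S"
    unfolding aff_direction_eq[OF v0S] aff affine_hull_span2[OF v0] set_us
    by (auto simp: image_iff intro!: exI[where x = "v0 + _"])
  obtain bs where bs: "orthonormal_frame (aff_direction S) bs"
    using ex_orthonormal_frame[of "aff_direction S"] subspace_span[of "set us"] spn by auto
  define D where "D = \<bar>Determinant.det (ray_matrix bs us)\<bar>"
  note \<mu> = aff_lebesgue_chart(1)[OF v0S bs us ind spn, folded D_def]
  have D: "0 < D" using aff_lebesgue_chart(2)[OF v0S bs us ind spn] by (simp add: D_def)
  have sum_C: "(\<Sum>v\<in>C. g v) = g v0 + (\<Sum>i<d. g (vs ! i))" for g :: "'a \<Rightarrow> 'b::comm_monoid_add"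
    using sum.remove[OF fin v0, of g] sum_set_nth[OF vs(2), of g] by (simp add: vs(1) len)
  have chart: "chart v0 us t = slack d t *\<^sub>R v0 + (\<Sum>i<d. t i *\<^sub>R vs ! i)" for t
  proof -
    have "(\<Sum>i<d. t i *\<^sub>R us ! i) = (\<Sum>i<d. t i *\<^sub>R vs ! i) - (\<Sum>i<d. t i) *\<^sub>R v0"
      by (simp add: us_def len scaleR_diff_right sum_subtractf scaleR_sum_left)
    then show ?thesis by (simp add: chart_def lu slack_def scaleR_diff_left)
  qed
  define w where "w t v = (if v = v0 then slack d t else t (the_inv_into {..<d} ((!) vs) v))" for t v
  have inj: "inj_on ((!) vs) {..<d}" using vs(2) by (simp add: inj_on_nth len)
  have w_nth: "w t (vs ! i) = t i" if "i < d" for t i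
    using that inj vs_C(2)[OF that] by (simp add: w_def the_inv_into_f_f)
  have w_v0: "w t v0 = slack d t" for t by (simp add: w_def)
  have w_sum: "sum (w t) C = 1" for t
  proof -
    have "(\<Sum>i<d. w t (vs ! i)) = (\<Sum>i<d. t i)" by (intro sum.cong refl w_nth) simp
    then show ?thesis by (simp add: sum_C w_v0 slack_def)
  qed
  have w_comb: "(\<Sum>v\<in>C. w t v *\<^sub>R v) = chart v0 us t" for t
  proof -
    have "(\<Sum>i<d. w t (vs ! i) *\<^sub>R vs ! i) = (\<Sum>i<d. t i *\<^sub>R vs ! i)"
      by (intro sum.cong refl) (simp add: w_nth)
    then show ?thesis by (simp add: sum_C w_v0 chart)
  qed
  have C_eq: "C = insert v0 ((!) vs ` {..<d})"
  proof -
    have "set vs = (!) vs ` {..<d}" by (auto simp: len[symmetric] set_conv_nth)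
    then show ?thesis using vs(1) v0 by auto
  qed
  have w_all: "\<forall>v\<in>C. P (w t v)" if "P (slack d t)" "\<And>i. i < d \<Longrightarrow> P (t i)" for P t
    using that unfolding C_eq by (auto simp: w_nth w_v0)
  have inj_chart: "t i = s i" if eq: "chart v0 us t = chart v0 us s" and i: "i < d" for t s i
  proof (rule ccontr)
    assume ne: "t i \<noteq> s i"
    have "(\<Sum>v\<in>C. (w t v - w s v) *\<^sub>R v) = (\<Sum>v\<in>C. w t v *\<^sub>R v) - (\<Sum>v\<in>C. w s v *\<^sub>R v)"
      by (simp only: scaleR_left_diff_distrib sum_subtractf)
    then have "(\<Sum>v\<in>C. (w t v - w s v) *\<^sub>R v) = 0" unfolding w_comb eq by simp
    moreover have "(\<Sum>v\<in>C. w t v - w s v) = 0" by (simp only: sum_subtractf w_sum diff_self)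
    moreover have "w t (vs ! i) - w s (vs ! i) \<noteq> 0" using ne by (simp add: w_nth[OF i])
    ultimately have "affine_dependent C"
      unfolding affine_dependent_explicit_finite[OF fin]
      using vs_C(1)[OF i] by (intro exI[of _ "\<lambda>v. w t v - w s v"]) auto
    with C(1) show False ..
  qed
  have mem: "chart v0 us t \<in> S \<longleftrightarrow> t \<in> corner d" for t
  proof
    assume "chart v0 us t \<in> S"
    then obtain a where a: "\<forall>v\<in>C. 0 \<le> a v" "sum a C = 1" "(\<Sum>v\<in>C. a v *\<^sub>R v) = chart v0 us t"
      unfolding S convex_hull_finite[OF fin] by auto
    define s where "s i = a (vs ! i)" for i
    have sl: "slack d s = a v0" using a(2) by (simp add: sum_C slack_def s_def)
    have "chart v0 us s = chart v0 us t" using a(3) by (simp add: chart[of s] sl s_def sum_C)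
    then have eq: "t i = s i" if "i < d" for i using inj_chart[of s t i] that by simp
    then have "slack d t = slack d s" by (simp add: slack_def)
    moreover have "0 \<le> s i" if "i < d" for i
      using a(1) vs_C(1)[OF that] by (simp add: s_def)
    ultimately show "t \<in> corner d" using eq sl a(1) v0 by (auto simp: corner_def)
  next
    assume "t \<in> corner d"
    then have "\<forall>v\<in>C. 0 \<le> w t v" by (intro w_all) (auto simp: corner_def)
    then show "chart v0 us t \<in> S"
      unfolding S convex_hull_finite[OF fin] mem_Collect_eq
      using w_sum[of t] w_comb[of t] by blast
  qed
  have ri: "chart v0 us t \<in> rel_interior S" if "0 < slack d t" "\<forall>i<d. 0 < t i" for t
  proof -
    have "\<forall>v\<in>C. 0 < w t v" using that by (intro w_all) auto
    then show ?thesis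
      unfolding S rel_interior_convex_hull_explicit[OF C(1)] mem_Collect_eq
      using w_sum[of t] w_comb[of t] by blast
  qed
  have sumv: "(\<Sum>v\<in>C. v) = (real d + 1) *\<^sub>R v0 + (\<Sum>i<d. us ! i)"
  proof -
    have "(\<Sum>i<d. us ! i) = (\<Sum>i<d. vs ! i) - real d *\<^sub>R v0"
      by (simp add: us_def len sum_subtractf sum_constant_scaleR)
    then show ?thesis by (simp add: sum_C scaleR_add_left)
  qed
  show thesis by (rule that[OF lu D \<mu> mem _ sumv]) (use ri in blast)
qed

lemma simplex_integrals:
  fixes C :: "'a::euclidean_space set"
  assumes C: "\<not> affine_dependent C" "card C = Suc d" and S: "S = convex hull C"
  shows "0 < aff_volume S"
    and "(\<integral>x. indicator S x *\<^sub>R x \<partial>aff_lebesgue S) = (aff_volume S / (real d + 1)) *\<^sub>R (\<Sum>v\<in>C. v)"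
    and "AE x in aff_lebesgue S. x \<in> S \<longrightarrow> x \<in> rel_interior S"
proof -
  obtain us D v0 where lu: "length us = d" and D: "0 < D"
    and \<mu>: "aff_lebesgue S = density (distr (leb (length us)) borel (chart v0 us)) (\<lambda>_. ennreal D)"
    and mem: "\<And>t. chart v0 us t \<in> S \<longleftrightarrow> t \<in> corner d"
    and ri: "\<forall>t. 0 < slack d t \<and> (\<forall>i<d. 0 < t i) \<longrightarrow> chart v0 us t \<in> rel_interior S"
    and sumv: "(\<Sum>v\<in>C. v) = (real d + 1) *\<^sub>R v0 + (\<Sum>i<d. us ! i)"
    by (rule simplex_chart[OF C S]) (rule that)
  have ind_mem: "indicator S (chart v0 us t) = (indicator (corner d) t :: real)" for t
    by (simp add: indicator_def mem)
  have "compact S" unfolding S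
    by (rule finite_imp_compact_convex_hull[OF aff_independent_finite[OF C(1)]])
  then have S_borel [measurable]: "S \<in> sets borel" by (simp add: borel_compact)
  show "AE x in aff_lebesgue S. x \<in> S \<longrightarrow> x \<in> rel_interior S"
  proof (rule AE_chart[OF \<mu>])
    have "{x. x \<in> S \<longrightarrow> x \<in> rel_interior S} = - S \<union> rel_interior S" by auto
    then show "{x. x \<in> S \<longrightarrow> x \<in> rel_interior S} \<in> sets borel"
      using S_borel borel_rel_interior[of S] by auto
    have "AE t in leb d. \<forall>i\<in>{..<d}. t i \<noteq> 0"
      by (rule AE_finite_allI) (auto intro: AE_leb_coordinate)
    with AE_leb_slack[of d] show "AE t in leb (length us). chart v0 us t \<in> S \<longrightarrow> chart v0 us t \<in> rel_interior S"
      unfolding lu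
    proof eventually_elim
      case (elim t)
      then show ?case by (auto simp: mem corner_def less_le intro!: ri[rule_format])
    qed
  qed
  let ?m = "\<integral>t. indicator (corner d) t \<partial>leb d :: real"
  have "sets (aff_lebesgue S) = sets borel" "space (aff_lebesgue S) = UNIV"
    unfolding \<mu> by auto
  then have "aff_volume S = (\<integral>x. indicator S x \<partial>aff_lebesgue S)"
    by (simp add: aff_volume_def)
  also have "\<dots> = D *\<^sub>R (\<integral>t. indicator S (chart v0 us t) \<partial>leb (length us))"
    by (rule integral_chart[OF \<mu>]) (use D in auto)
  finally have vol: "aff_volume S = D * ?m" by (simp add: ind_mem lu)
  show "0 < aff_volume S" using vol D corner_moments(1)[of d] by simp
  have "(\<integral>x. indicator S x *\<^sub>R x \<partial>aff_lebesgue S)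
      = D *\<^sub>R (\<integral>t. indicator S (chart v0 us t) *\<^sub>R chart v0 us t \<partial>leb (length us))"
    by (rule integral_chart[OF \<mu>]) (use D in auto)
  also have "(\<integral>t. indicator S (chart v0 us t) *\<^sub>R chart v0 us t \<partial>leb (length us))
      = (\<integral>t. indicator (corner d) t *\<^sub>R v0 + (\<Sum>i<d. (indicator (corner d) t * t i) *\<^sub>R us ! i) \<partial>leb d)"
    unfolding lu ind_mem by (simp add: chart_def lu scaleR_add_right scaleR_sum_right del: indicator_scaleR_eq_if)
  also have "\<dots> = ?m *\<^sub>R v0 + (\<Sum>i<d. (?m / (real d + 1)) *\<^sub>R us ! i)"
  proof -
    have int: "integrable (leb d) (\<lambda>t. (indicator (corner d) t * t i) *\<^sub>R us ! i)" if "i < d" for i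
      by (rule integrable_scaleR_left) (rule corner_moments(3)[OF that])
    have "(\<integral>t. (\<Sum>i<d. (indicator (corner d) t * t i) *\<^sub>R us ! i) \<partial>leb d)
        = (\<Sum>i<d. \<integral>t. (indicator (corner d) t * t i) *\<^sub>R us ! i \<partial>leb d)"
      by (rule Bochner_Integration.integral_sum) (use int in auto)
    also have "\<dots> = (\<Sum>i<d. (?m / (real d + 1)) *\<^sub>R us ! i)"
    proof (rule sum.cong[OF refl])
      fix i assume "i \<in> {..<d}"
      then have i: "i < d" by simp
      show "(\<integral>t. (indicator (corner d) t * t i) *\<^sub>R us ! i \<partial>leb d) = (?m / (real d + 1)) *\<^sub>R us ! i"
        by (subst integral_scaleR_left) (auto simp only: corner_moments(3,4)[OF i])
    qed
    finally have sum: "(\<integral>t. (\<Sum>i<d. (indicator (corner d) t * t i) *\<^sub>R us ! i) \<partial>leb d)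
        = (\<Sum>i<d. (?m / (real d + 1)) *\<^sub>R us ! i)" .
    have "integrable (leb d) (\<lambda>t. \<Sum>i<d. (indicator (corner d) t * t i) *\<^sub>R us ! i)"
      by (rule Bochner_Integration.integrable_sum) (use int in auto)
    moreover have "integrable (leb d) (\<lambda>t. (indicator (corner d) t :: real) *\<^sub>R v0)"
      by (rule integrable_scaleR_left) (rule corner_moments(2))
    moreover have "(\<integral>t. (indicator (corner d) t :: real) *\<^sub>R v0 \<partial>leb d) = ?m *\<^sub>R v0"
      by (rule integral_scaleR_left) (rule corner_moments(2))
    ultimately show ?thesis by (simp only: Bochner_Integration.integral_add sum)
  qed
  also have "\<dots> = (?m / (real d + 1)) *\<^sub>R (\<Sum>v\<in>C. v)"
  proof -
    have "?m / (real d + 1) * (real d + 1) = ?m" by simp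
    then show ?thesis unfolding sumv by (simp only: scaleR_add_right scaleR_scaleR scaleR_sum_right)
  qed
  finally show "(\<integral>x. indicator S x *\<^sub>R x \<partial>aff_lebesgue S) = (aff_volume S / (real d + 1)) *\<^sub>R (\<Sum>v\<in>C. v)"
    by (simp add: vol)
qed

section \<open>Simplicial cones\<close>

lemma convex_cone_hull_list:
  "convex_cone hull (set rs) = {chart 0 rs t | t. \<forall>i<length rs. 0 \<le> t i}" (is "_ = ?T")
proof
  show "convex_cone hull (set rs) \<subseteq> ?T"
  proof (rule hull_minimal)
    show "set rs \<subseteq> ?T"
    proof
      fix r assume "r \<in> set rs"
      then obtain k where k: "k < length rs" "r = rs ! k" by (auto simp: in_set_conv_nth)
      have "chart 0 rs (\<lambda>i. if i = k then 1 else 0) = (\<Sum>i<length rs. if i = k then rs ! i else 0)"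
        unfolding chart_def by (simp add: if_distrib[of "\<lambda>c. c *\<^sub>R _"] cong: if_cong)
      also have "\<dots> = r" using k by simp
      finally have "r = chart 0 rs (\<lambda>i. if i = k then 1 else 0)" ..
      then show "r \<in> ?T" by fastforce
    qed
    show "convex_cone ?T"
      unfolding convex_cone_iff
    proof (intro conjI ballI allI impI)
      have "0 = chart 0 rs (\<lambda>_. 0)" by (simp add: chart_def)
      then show "0 \<in> ?T" by fastforce
    next
      fix x y assume "x \<in> ?T" "y \<in> ?T"
      then obtain t s where ts: "x = chart 0 rs t" "y = chart 0 rs s"
        "\<forall>i<length rs. 0 \<le> t i" "\<forall>i<length rs. 0 \<le> s i" by auto
      have "x + y = chart 0 rs (\<lambda>i. t i + s i)"
        by (simp add: ts chart_def scaleR_add_left sum.distrib)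
      moreover have "\<forall>i<length rs. 0 \<le> t i + s i" using ts(3,4) by simp
      ultimately show "x + y \<in> ?T" by blast
    next
      fix x and c :: real assume "x \<in> ?T" and c: "0 \<le> c"
      then obtain t where t: "x = chart 0 rs t" "\<forall>i<length rs. 0 \<le> t i" by auto
      have "c *\<^sub>R x = chart 0 rs (\<lambda>i. c * t i)"
        by (simp add: t chart_def scaleR_sum_right)
      moreover have "\<forall>i<length rs. 0 \<le> c * t i" using t(2) c by simp
      ultimately show "c *\<^sub>R x \<in> ?T" by blast
    qed
  qed
  show "?T \<subseteq> convex_cone hull (set rs)"
  proof
    fix x assume "x \<in> ?T"
    then obtain t where t: "x = chart 0 rs t" "\<forall>i<length rs. 0 \<le> t i" by auto
    have "(\<Sum>i<n. t i *\<^sub>R rs ! i) \<in> convex_cone hull (set rs)" if "n \<le> length rs" for n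
      using that
    proof (induction n)
      case 0
      then show ?case by (simp add: convex_cone_hull_contains_0)
    next
      case (Suc n)
      then have "t n *\<^sub>R rs ! n \<in> convex_cone hull (set rs)"
        using t(2) by (intro convex_cone_hull_mul hull_inc) auto
      then show ?case using Suc by (simp add: convex_cone_hull_add)
    qed
    then show "x \<in> convex_cone hull (set rs)" by (simp add: t chart_def)
  qed
qed

lemma chart_mem_cone:
  assumes rs: "distinct rs" "independent (set rs)"
  shows "chart 0 rs t \<in> convex_cone hull (set rs) \<longleftrightarrow> (\<forall>i<length rs. 0 \<le> t i)"
proof
  assume "chart 0 rs t \<in> convex_cone hull (set rs)"
  then obtain s where s: "chart 0 rs t = chart 0 rs s" "\<forall>i<length rs. 0 \<le> s i"
    unfolding convex_cone_hull_list by auto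
  have "(\<Sum>j<length rs. (t j - s j) *\<^sub>R rs ! j) = 0"
    using s(1) by (simp add: chart_def scaleR_diff_left sum_subtractf)
  then have "t i - s i = 0" if "i < length rs" for i
    using independent_list_coefficients[OF rs, of "\<lambda>j. t j - s j" i] that by simp
  with s(2) show "\<forall>i<length rs. 0 \<le> t i" by auto
qed (auto simp: convex_cone_hull_list)

text \<open>From any point of the cone one can continue a little beyond a point with positive
  coordinates without leaving the cone; \<open>\<delta>\<close> is chosen small enough for all coordinates at once.\<close>

lemma chart_mem_rel_interior_cone:
  assumes rs: "distinct rs" "independent (set rs)" and pos: "\<forall>i<length rs. 0 < t i"
  shows "chart 0 rs t \<in> rel_interior (convex_cone hull (set rs))"
  unfolding convex_rel_interior_iff[OF convex_convex_cone_hull convex_cone_hull_nonempty]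
proof
  fix x assume "x \<in> convex_cone hull (set rs)"
  then obtain s where s: "x = chart 0 rs s" "\<forall>i<length rs. 0 \<le> s i"
    unfolding convex_cone_hull_list by auto
  define \<delta> where "\<delta> = Min (insert 1 ((\<lambda>i. t i / (1 + s i)) ` {..<length rs}))"
  have "0 < t i / (1 + s i)" if "i < length rs" for i
    using pos s(2) that by (simp add: add_pos_nonneg)
  then have \<delta>: "0 < \<delta>" unfolding \<delta>_def by (subst Min_gr_iff) auto
  have nonneg: "0 \<le> (1 - (1 + \<delta>)) * s i + (1 + \<delta>) * t i" if i: "i < length rs" for i
  proof -
    have "\<delta> \<le> t i / (1 + s i)" unfolding \<delta>_def using i by (intro Min_le) auto
    then have "\<delta> * (1 + s i) \<le> t i" using s(2) i by (simp add: pos_le_divide_eq add_pos_nonneg)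
    moreover have "0 < \<delta> * t i" using \<delta> pos i by (simp del: mult_pos_pos add: mult_pos_pos)
    ultimately show ?thesis using \<delta> by (simp add: algebra_simps)
  qed
  have "(1 - (1 + \<delta>)) *\<^sub>R x + (1 + \<delta>) *\<^sub>R chart 0 rs t
      = chart 0 rs (\<lambda>i. (1 - (1 + \<delta>)) * s i + (1 + \<delta>) * t i)"
    by (simp only: s(1) chart_def add_0_left scaleR_sum_right scaleR_scaleR scaleR_add_left sum.distrib)
  then have "(1 - (1 + \<delta>)) *\<^sub>R x + (1 + \<delta>) *\<^sub>R chart 0 rs t \<in> convex_cone hull (set rs)"
    using nonneg chart_mem_cone[OF rs] by auto
  then show "\<exists>e>1. (1 - e) *\<^sub>R x + e *\<^sub>R chart 0 rs t \<in> convex_cone hull (set rs)"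
    using \<delta> by (intro exI[of _ "1 + \<delta>"]) simp
qed

lemma span_convex_cone_hull: "span (convex_cone hull R) = span R"
proof
  have "convex_cone hull R \<subseteq> span R"
    by (rule hull_minimal) (rule span_superset, rule convex_cone_span)
  then show "span (convex_cone hull R) \<subseteq> span R" by (rule span_minimal) (rule subspace_span)
  show "span R \<subseteq> span (convex_cone hull R)" by (rule span_mono) (rule hull_subset)
qed

lemma aff_direction_cone:
  assumes "0 \<in> S"
  shows "aff_direction S = span S"
  using aff_direction_eq[of 0 S] affine_hull_span_0[of S] hull_inc[OF assms] by auto

text \<open>The exponential is bounded below by a positive constant on the unit interval, and by one on the
  whole half line if \<open>\<rho>\<close> is nonnegative.\<close>

lemma nn_integral_ray:
  fixes \<rho> :: real
  defines "J \<equiv> (\<integral>\<^sup>+x. ennreal (indicator {0..} x * exp (\<rho> * x)) \<partial>lborel)"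
  shows "J \<noteq> 0" and "0 \<le> \<rho> \<Longrightarrow> J = \<top>"
proof -
  have bound: "ennreal (b * c) \<le> J" if "0 \<le> b" "0 \<le> c" "\<And>x. 0 \<le> x \<Longrightarrow> x \<le> b \<Longrightarrow> c \<le> exp (\<rho> * x)" for b c
  proof -
    have "ennreal (b * c) = ennreal c * emeasure lborel {0..b}"
      using that by (simp add: mult.commute ennreal_mult)
    also have "\<dots> = (\<integral>\<^sup>+x. ennreal c * indicator {0..b} x \<partial>lborel)"
      by (rule nn_integral_cmult_indicator[symmetric]) simp
    also have "\<dots> \<le> J"
      unfolding J_def using that by (intro nn_integral_mono) (auto simp: indicator_def)
    finally show ?thesis .
  qed
  have "min 1 (exp \<rho>) \<le> exp (\<rho> * x)" if "0 \<le> x" "x \<le> 1" for x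
  proof (cases "0 \<le> \<rho>")
    case True
    then show ?thesis using that by (simp add: min_le_iff_disj)
  next
    case False
    then have "\<rho> \<le> \<rho> * x" using that by (simp add: mult_le_cancel_left1)
    then show ?thesis by (simp add: min_le_iff_disj)
  qed
  then have le: "ennreal (1 * min 1 (exp \<rho>)) \<le> J" by (intro bound) auto
  have "0 < ennreal (1 * min 1 (exp \<rho>))" by (simp add: min_def)
  also note le
  finally show "J \<noteq> 0" by simp
  assume \<rho>: "0 \<le> \<rho>"
  have le: "ennreal (real n * 1) \<le> J" for n
    using \<rho> by (intro bound) auto
  show "J = \<top>"
  proof (rule ccontr)
    assume "J \<noteq> \<top>"
    then obtain r where r: "J = ennreal r" "0 \<le> r" by (cases J) auto
    obtain n where "r < real n" using reals_Archimedean2 by blast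
    moreover have "real n \<le> r" using le[of n] r by simp
    ultimately show False by simp
  qed
qed

text \<open>Finiteness of the product forces finiteness of each one-dimensional factor because none of the
  factors vanishes. This turns integrability of the exponential into negativity on the generators.\<close>

lemma nn_integral_leb_prod_ray_finite:
  assumes fin: "(\<integral>\<^sup>+t. (\<Prod>i<d. ennreal (indicator {0..} (t i) * exp (\<rho> i * t i))) \<partial>leb d) < \<top>"
    and k: "k < d"
  shows "\<rho> k < 0"
proof (rule ccontr)
  interpret product_sigma_finite "\<lambda>_::nat. lborel :: real measure" ..
  assume "\<not> \<rho> k < 0"
  have "(\<integral>\<^sup>+t. (\<Prod>i<d. ennreal (indicator {0..} (t i) * exp (\<rho> i * t i))) \<partial>leb d)
      = (\<Prod>i<d. \<integral>\<^sup>+x. ennreal (indicator {0..} x * exp (\<rho> i * x)) \<partial>lborel)"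
    by (rule product_nn_integral_prod) auto
  also have "\<dots> = \<top>"
    unfolding ennreal_prod_eq_top using nn_integral_ray[of "\<rho> _"] k \<open>\<not> \<rho> k < 0\<close>
    by (auto intro!: bexI[of _ k])
  finally show False using fin by simp
qed

text \<open>Both integrals factor into one-dimensional moments \<open>fact m / l ^ Suc m\<close> of the exponential, where
  \<open>m\<close> is one in the coordinate \<open>k\<close> and zero elsewhere.\<close>

lemma has_bochner_integral_leb_prod_exp:
  assumes neg: "\<And>i. i < d \<Longrightarrow> \<rho> i < 0"
  defines "e \<equiv> (\<lambda>t. \<Prod>i<d. indicator {0..} (t i) * exp (\<rho> i * t i))"
  shows "has_bochner_integral (leb d) e (\<Prod>i<d. 1 / - \<rho> i)"
    and "k < d \<Longrightarrow> has_bochner_integral (leb d) (\<lambda>t. e t * t k) ((\<Prod>i<d. 1 / - \<rho> i) * (1 / - \<rho> k))"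
proof -
  interpret product_sigma_finite "\<lambda>_::nat. lborel :: real measure" ..
  have gen: "has_bochner_integral (leb d)
      (\<lambda>t. \<Prod>i<d. indicator {0..} (t i) * (t i ^ m i * exp (\<rho> i * t i))) (\<Prod>i<d. fact (m i) / (- \<rho> i) ^ Suc (m i))" for m
  proof -
    have one: "has_bochner_integral lborel (\<lambda>x. indicator {0..} x * (x ^ m i * exp (\<rho> i * x)))
        (fact (m i) / (- \<rho> i) ^ Suc (m i))" if "i < d" for i
      using has_bochner_integral_power_exp[of "- \<rho> i" "m i"] neg[OF that] by simp
    then have int: "integrable lborel (\<lambda>x. indicator {0..} x * (x ^ m i * exp (\<rho> i * x)))" if "i \<in> {..<d}" for i
      using that by (auto simp: has_bochner_integral_iff)
    have val: "(\<integral>x. indicator {0..} x * (x ^ m i * exp (\<rho> i * x)) \<partial>lborel) = fact (m i) / (- \<rho> i) ^ Suc (m i)" if "i \<in> {..<d}" for i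
      using that one by (intro has_bochner_integral_integral_eq) auto
    have "(\<integral>t. (\<Prod>i<d. indicator {0..} (t i) * (t i ^ m i * exp (\<rho> i * t i))) \<partial>leb d)
      = (\<Prod>i<d. \<integral>x. indicator {0..} x * (x ^ m i * exp (\<rho> i * x)) \<partial>lborel)"
      by (rule product_integral_prod[OF _ int]) auto
    also have "\<dots> = (\<Prod>i<d. fact (m i) / (- \<rho> i) ^ Suc (m i))"
      by (rule prod.cong[OF refl val])
    finally show ?thesis
      using product_integrable_prod[OF _ int, of "{..<d}"] by (simp add: has_bochner_integral_iff)
  qed
  show "has_bochner_integral (leb d) e (\<Prod>i<d. 1 / - \<rho> i)"
    using gen[of "\<lambda>_. 0"] by (simp add: e_def)
  assume k: "k < d"
  let ?m = "\<lambda>i. if i = k then 1 else 0 :: nat"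
  have "(\<lambda>t. \<Prod>i<d. indicator {0..} (t i) * (t i ^ ?m i * exp (\<rho> i * t i))) = (\<lambda>t. e t * t k)"
  proof
    fix t :: "nat \<Rightarrow> real"
    have "(\<Prod>i<d. indicator {0..} (t i) * (t i ^ ?m i * exp (\<rho> i * t i)))
        = (\<Prod>i<d. (indicator {0..} (t i) * exp (\<rho> i * t i)) * (if i = k then t i else 1))"
      by (intro prod.cong) auto
    also have "\<dots> = e t * t k" using k by (simp add: e_def prod.distrib)
    finally show "(\<Prod>i<d. indicator {0..} (t i) * (t i ^ ?m i * exp (\<rho> i * t i))) = e t * t k" .
  qed
  moreover have "(\<Prod>i<d. fact (?m i) / (- \<rho> i) ^ Suc (?m i)) = (\<Prod>i<d. 1 / - \<rho> i) * (1 / - \<rho> k)"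
  proof -
    have "(\<Prod>i<d. fact (?m i) / (- \<rho> i) ^ Suc (?m i)) = (\<Prod>i<d. (1 / - \<rho> i) * (if i = k then 1 / - \<rho> i else 1))"
      by (intro prod.cong) (auto simp: power2_eq_square)
    also have "\<dots> = (\<Prod>i<d. 1 / - \<rho> i) * (\<Prod>i<d. if i = k then 1 / - \<rho> i else 1)"
      by (rule prod.distrib)
    also have "(\<Prod>i<d. if i = k then 1 / - \<rho> i else 1) = 1 / - \<rho> k" using k by simp
    finally show ?thesis .
  qed
  ultimately show "has_bochner_integral (leb d) (\<lambda>t. e t * t k) ((\<Prod>i<d. 1 / - \<rho> i) * (1 / - \<rho> k))"
    using gen[of ?m] by simp
qed

lemma indicator_cone_chart:
  assumes rs: "distinct rs" "independent (set rs)"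
  shows "indicator (convex_cone hull (set rs)) (chart 0 rs t) * exp (\<theta> \<bullet> chart 0 rs t)
    = (\<Prod>i<length rs. indicator {0..} (t i) * exp ((\<theta> \<bullet> rs ! i) * t i) :: real)"
proof -
  have "(\<Prod>i<length rs. indicator {0..} (t i)) = (indicator (convex_cone hull (set rs)) (chart 0 rs t) :: real)"
    unfolding indicator_def chart_mem_cone[OF rs] by (auto simp: prod_zero_iff)
  moreover have "exp (\<theta> \<bullet> chart 0 rs t) = (\<Prod>i<length rs. exp ((\<theta> \<bullet> rs ! i) * t i))"
    by (simp add: chart_def inner_sum_right exp_sum mult.commute)
  ultimately show ?thesis by (simp add: prod.distrib)
qed

lemma cone_integrals:
  fixes rs :: "'a::euclidean_space list"
  assumes rs: "distinct rs" "independent (set rs)" and S: "S = convex_cone hull (set rs)"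
    and bs: "orthonormal_frame (span S) bs"
    and int: "set_integrable (aff_lebesgue S) S (\<lambda>x. exp (\<theta> \<bullet> x))"
  shows "exp_integral S \<theta> = \<bar>Determinant.det (ray_matrix bs rs)\<bar> * (\<Prod>r\<in>set rs. 1 / - (r \<bullet> \<theta>))"
    and "0 < exp_integral S \<theta>"
    and "(\<integral>x. (indicator S x * exp (\<theta> \<bullet> x)) *\<^sub>R x \<partial>aff_lebesgue S)
      = exp_integral S \<theta> *\<^sub>R (\<Sum>r\<in>set rs. (1 / - (r \<bullet> \<theta>)) *\<^sub>R r)"
    and "AE x in aff_lebesgue S. x \<in> S \<longrightarrow> x \<in> rel_interior S"
    and "S \<in> sets borel"
proof -
  let ?d = "length rs"
  define D where "D = \<bar>Determinant.det (ray_matrix bs rs)\<bar>"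
  define \<rho> where "\<rho> i = \<theta> \<bullet> rs ! i" for i
  define e where "e t = (\<Prod>i<?d. indicator {0..} (t i) * exp (\<rho> i * t i))" for t :: "nat \<Rightarrow> real"
  have "0 \<in> S" unfolding S by (rule convex_cone_hull_contains_0)
  then have dir: "aff_direction S = span S" and a: "0 \<in> affine hull S"
    by (simp_all add: aff_direction_cone hull_inc)
  have spn: "span (set rs) = aff_direction S" unfolding dir by (simp add: S span_convex_cone_hull)
  note bs' = bs[folded dir]
  note \<mu> = aff_lebesgue_chart(1)[OF a bs' rs spn, folded D_def]
  have D: "0 < D" using aff_lebesgue_chart(2)[OF a bs' rs spn] by (simp add: D_def)
  have "closed S" unfolding S by (rule closed_convex_cone_hull) simp
  then show S_borel: "S \<in> sets borel" by (rule borel_closed)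
  note [measurable] = S_borel
  have ind: "indicator S (chart 0 rs t) * exp (\<theta> \<bullet> chart 0 rs t) = e t" for t
    unfolding S e_def \<rho>_def by (rule indicator_cone_chart[OF rs])
  show "AE x in aff_lebesgue S. x \<in> S \<longrightarrow> x \<in> rel_interior S"
  proof (rule AE_chart[OF \<mu>])
    have "{x. x \<in> S \<longrightarrow> x \<in> rel_interior S} = - S \<union> rel_interior S" by auto
    then show "{x. x \<in> S \<longrightarrow> x \<in> rel_interior S} \<in> sets borel"
      using S_borel borel_rel_interior[of S] by auto
    have "AE t in leb ?d. \<forall>i\<in>{..<?d}. t i \<noteq> 0"
      by (rule AE_finite_allI) (auto intro: AE_leb_coordinate)
    then show "AE t in leb ?d. chart 0 rs t \<in> S \<longrightarrow> chart 0 rs t \<in> rel_interior S"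
    proof eventually_elim
      case (elim t)
      then show ?case
        unfolding S chart_mem_cone[OF rs] by (auto simp: less_le intro!: chart_mem_rel_interior_cone[OF rs])
    qed
  qed
  have neg: "\<rho> i < 0" if "i < ?d" for i
  proof (rule nn_integral_leb_prod_ray_finite[OF _ that])
    have e_nn: "ennreal (e t) = (\<Prod>i<?d. ennreal (indicator {0..} (t i) * exp (\<rho> i * t i)))" for t
      unfolding e_def by (rule prod_ennreal[symmetric]) simp
    have "integrable (aff_lebesgue S) (\<lambda>x. indicator S x * exp (\<theta> \<bullet> x))"
      using int by (simp add: set_integrable_def)
    then have "(\<integral>\<^sup>+x. ennreal (norm (indicator S x * exp (\<theta> \<bullet> x))) \<partial>aff_lebesgue S) < \<infinity>"
      by (simp add: integrable_iff_bounded)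
    also have "(\<integral>\<^sup>+x. ennreal (norm (indicator S x * exp (\<theta> \<bullet> x))) \<partial>aff_lebesgue S)
        = (\<integral>\<^sup>+x. ennreal (indicator S x * exp (\<theta> \<bullet> x)) \<partial>aff_lebesgue S)"
      by (intro nn_integral_cong) simp
    also have "\<dots> = ennreal D * (\<integral>\<^sup>+t. ennreal (indicator S (chart 0 rs t) * exp (\<theta> \<bullet> chart 0 rs t)) \<partial>leb ?d)"
      by (rule nn_integral_chart[OF \<mu>]) measurable
    finally show "(\<integral>\<^sup>+t. (\<Prod>i<?d. ennreal (indicator {0..} (t i) * exp (\<rho> i * t i))) \<partial>leb ?d) < \<top>"
      using D unfolding ind e_nn by (auto simp: ennreal_mult_less_top)
  qed
  have prods: "(\<Prod>r\<in>set rs. 1 / - (r \<bullet> \<theta>)) = (\<Prod>i<?d. 1 / - \<rho> i)"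
    using prod.reindex_bij_betw[OF bij_betw_nth[OF rs(1) refl refl], of "\<lambda>r. 1 / - (r \<bullet> \<theta>)"]
    by (simp add: \<rho>_def inner_commute)
  note E0 = has_bochner_integral_leb_prod_exp(1)[of ?d \<rho>, OF neg, folded e_def]
  note E1 = has_bochner_integral_leb_prod_exp(2)[of ?d \<rho>, OF neg, folded e_def]
  have "exp_integral S \<theta> = (\<integral>x. indicator S x * exp (\<theta> \<bullet> x) \<partial>aff_lebesgue S)"
    by (simp add: exp_integral_def set_lebesgue_integral_def)
  also have "\<dots> = D *\<^sub>R (\<integral>t. indicator S (chart 0 rs t) * exp (\<theta> \<bullet> chart 0 rs t) \<partial>leb ?d)"
    by (rule integral_chart[OF \<mu>]) (use D in auto)
  also have "\<dots> = D * (\<Prod>i<?d. 1 / - \<rho> i)"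
    unfolding ind using has_bochner_integral_integral_eq[OF E0] by simp
  finally have val: "exp_integral S \<theta> = D * (\<Prod>i<?d. 1 / - \<rho> i)" .
  then show "exp_integral S \<theta> = \<bar>Determinant.det (ray_matrix bs rs)\<bar> * (\<Prod>r\<in>set rs. 1 / - (r \<bullet> \<theta>))"
    by (simp only: prods D_def)
  have "0 < (\<Prod>i<?d. 1 / - \<rho> i)" using neg by (intro prod_pos) auto
  with D show "0 < exp_integral S \<theta>" by (simp add: val)
  have "(\<integral>x. (indicator S x * exp (\<theta> \<bullet> x)) *\<^sub>R x \<partial>aff_lebesgue S)
      = D *\<^sub>R (\<integral>t. (indicator S (chart 0 rs t) * exp (\<theta> \<bullet> chart 0 rs t)) *\<^sub>R chart 0 rs t \<partial>leb ?d)"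
    by (rule integral_chart[OF \<mu>]) (use D in auto)
  also have "(\<integral>t. (indicator S (chart 0 rs t) * exp (\<theta> \<bullet> chart 0 rs t)) *\<^sub>R chart 0 rs t \<partial>leb ?d)
      = (\<integral>t. (\<Sum>i<?d. (e t * t i) *\<^sub>R rs ! i) \<partial>leb ?d)"
    unfolding ind by (simp add: chart_def scaleR_sum_right)
  also have "\<dots> = (\<Sum>i<?d. ((\<Prod>i<?d. 1 / - \<rho> i) * (1 / - \<rho> i)) *\<^sub>R rs ! i)"
  proof -
    have "has_bochner_integral (leb ?d) (\<lambda>t. \<Sum>i<?d. (e t * t i) *\<^sub>R rs ! i)
        (\<Sum>i<?d. ((\<Prod>i<?d. 1 / - \<rho> i) * (1 / - \<rho> i)) *\<^sub>R rs ! i)"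
      by (intro has_bochner_integral_sum has_bochner_integral_scaleR_left E1) auto
    then show ?thesis by (rule has_bochner_integral_integral_eq)
  qed
  also have "D *\<^sub>R \<dots> = exp_integral S \<theta> *\<^sub>R (\<Sum>i<?d. (1 / - \<rho> i) *\<^sub>R rs ! i)"
    by (simp only: val scaleR_sum_right scaleR_scaleR mult.assoc)
  also have "(\<Sum>i<?d. (1 / - \<rho> i) *\<^sub>R rs ! i) = (\<Sum>r\<in>set rs. (1 / - (r \<bullet> \<theta>)) *\<^sub>R r)"
    by (simp add: sum_set_nth[OF rs(1)] \<rho>_def inner_commute)
  finally show "(\<integral>x. (indicator S x * exp (\<theta> \<bullet> x)) *\<^sub>R x \<partial>aff_lebesgue S)
      = exp_integral S \<theta> *\<^sub>R (\<Sum>r\<in>set rs. (1 / - (r \<bullet> \<theta>)) *\<^sub>R r)" .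
qed

section \<open>Extreme rays of simplicial cones\<close>

lemma conic_hull_singleton: "conic hull {r :: 'a::real_vector} = {c *\<^sub>R r | c. 0 \<le> c}"
  by (auto simp: conic_hull_explicit)

text \<open>If a point on the ray lies strictly between two points of the cone, then in each other direction
  the coordinates of these two points are nonnegative and average to zero with positive weights.
  They vanish, so both points lie on the ray.\<close>

lemma extreme_ray_of_generator:
  assumes R: "independent R" and r: "r \<in> R"
  shows "conic hull {r :: 'a::euclidean_space} extreme_ray_of (convex_cone hull R)"
proof -
  let ?S = "convex_cone hull R" and ?F = "conic hull {r}"
  obtain rs where rs: "set rs = R" "distinct rs"
    using finite_distinct_list[OF finiteI_independent[OF R]] by blast
  obtain k where k: "k < length rs" "r = rs ! k" using r rs by (auto simp: in_set_conv_nth)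
  note R' = rs(2) R[folded rs(1)]
  have chart_k: "chart 0 rs t = t k *\<^sub>R r" if "\<And>i. i < length rs \<Longrightarrow> i \<noteq> k \<Longrightarrow> t i = 0" for t
  proof -
    have "(\<Sum>i<length rs. t i *\<^sub>R rs ! i) = (\<Sum>i<length rs. if i = k then t i *\<^sub>R rs ! i else 0)"
      using that by (intro sum.cong) auto
    then show ?thesis using k by (simp add: chart_def)
  qed
  have "?F face_of ?S"
    unfolding face_of_def
  proof (intro conjI ballI impI)
    show "?F \<subseteq> ?S" using r by (auto simp: conic_hull_singleton intro: convex_cone_hull_mul hull_inc)
    show "convex ?F" by (rule convex_conic_hull) simp
  next
    fix a b x assume ab: "a \<in> ?S" "b \<in> ?S" and x: "x \<in> ?F" "x \<in> open_segment a b"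
    obtain s t where st: "a = chart 0 rs s" "b = chart 0 rs t"
      "\<forall>i<length rs. 0 \<le> s i" "\<forall>i<length rs. 0 \<le> t i"
      using ab unfolding rs(1)[symmetric] convex_cone_hull_list by auto
    obtain u where u: "0 < u" "u < 1" "x = (1 - u) *\<^sub>R a + u *\<^sub>R b"
      using x(2) by (auto simp: in_segment)
    obtain c where c: "x = c *\<^sub>R r" using x(1) by (auto simp: conic_hull_singleton)
    have "x = chart 0 rs (\<lambda>i. (1 - u) * s i + u * t i)"
      by (simp only: u(3) st(1,2) chart_def add_0_left scaleR_sum_right scaleR_scaleR scaleR_add_left sum.distrib)
    moreover have "x = chart 0 rs (\<lambda>i. if i = k then c else 0)" by (subst chart_k) (auto simp: c)
    ultimately have "(\<Sum>i<length rs. ((1 - u) * s i + u * t i - (if i = k then c else 0)) *\<^sub>R rs ! i) = 0"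
      by (simp add: chart_def scaleR_diff_left sum_subtractf)
    then have z: "(1 - u) * s i + u * t i = 0" if "i < length rs" "i \<noteq> k" for i
      using independent_list_coefficients[OF R', of "\<lambda>i. (1 - u) * s i + u * t i - (if i = k then c else 0)" i] that by simp
    have "s i = 0 \<and> t i = 0" if i: "i < length rs" "i \<noteq> k" for i
    proof -
      have "0 \<le> (1 - u) * s i" "0 \<le> u * t i" using u st i by auto
      with z[OF i] have "(1 - u) * s i = 0" "u * t i = 0" by linarith+
      then show ?thesis using u by auto
    qed
    then have "a = s k *\<^sub>R r" "b = t k *\<^sub>R r" by (simp_all add: st(1,2) chart_k)
    then show "a \<in> ?F" "b \<in> ?F" using st(3,4) k by (auto simp: conic_hull_singleton)
  qed
  moreover have "r \<noteq> 0" using R r dependent_zero by blast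
  ultimately show ?thesis unfolding extreme_ray_of_def by blast
qed

text \<open>Write a spanning vector \<open>x\<close> of the ray as \<open>?p + ?q\<close>, where \<open>?p\<close> is a nonzero multiple of one generator.
  The face contains \<open>x\<close>, the midpoint of \<open>2 *\<^sub>R ?p\<close> and \<open>2 *\<^sub>R ?q\<close>, hence also \<open>2 *\<^sub>R ?p\<close>.\<close>

lemma extreme_ray_of_cone_generated:
  assumes R: "finite R" and F: "F extreme_ray_of (convex_cone hull (R :: 'a::euclidean_space set))"
  obtains r where "r \<in> R" "r \<noteq> 0" "F = conic hull {r}"
proof -
  obtain x where x: "x \<noteq> 0" "F = conic hull {x}" and face: "F face_of convex_cone hull R"
    using F by (auto simp: extreme_ray_of_def)
  obtain rs where rs: "set rs = R" "distinct rs" using finite_distinct_list[OF R] by blast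
  have "x \<in> F" unfolding x(2) by (simp add: hull_inc)
  then have "x \<in> convex_cone hull R" using face_of_imp_subset[OF face] by blast
  then obtain t where t: "x = chart 0 rs t" "\<forall>i<length rs. 0 \<le> t i"
    unfolding rs(1)[symmetric] convex_cone_hull_list by auto
  have "\<exists>k<length rs. t k *\<^sub>R rs ! k \<noteq> 0"
  proof (rule ccontr)
    assume "\<not> ?thesis"
    then have "x = 0" unfolding t(1) chart_def by (simp add: sum.neutral)
    with x(1) show False ..
  qed
  then obtain k where k: "k < length rs" "t k *\<^sub>R rs ! k \<noteq> 0" by blast
  let ?p = "t k *\<^sub>R rs ! k"
  let ?q = "\<Sum>i\<in>{..<length rs} - {k}. t i *\<^sub>R rs ! i"
  have pq: "x = ?p + ?q" using k(1) by (simp add: t chart_def sum.remove[of "{..<length rs}" k])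
  have "?p \<in> convex_cone hull R"
    using t(2) k rs(1) by (intro convex_cone_hull_mul hull_inc) auto
  then have p: "2 *\<^sub>R ?p \<in> convex_cone hull R" by (rule convex_cone_hull_mul) simp
  have "?q = chart 0 rs (\<lambda>i. if i = k then 0 else t i)"
    using k(1) by (simp add: chart_def sum.remove[of "{..<length rs}" k])
  also have "\<dots> \<in> convex_cone hull R"
    unfolding rs(1)[symmetric] convex_cone_hull_list using t(2) by fastforce
  finally have q: "2 *\<^sub>R ?q \<in> convex_cone hull R" by (rule convex_cone_hull_mul) simp
  have "2 *\<^sub>R ?p \<in> F"
  proof (cases "2 *\<^sub>R ?p = 2 *\<^sub>R ?q")
    case True
    then have "?p = ?q" by (simp only: scaleR_cancel_left) simp
    then have "2 *\<^sub>R ?p = x" using pq by (simp only: scaleR_2)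
    then show ?thesis using \<open>x \<in> F\<close> by simp
  next
    case False
    then have "x \<in> open_segment (2 *\<^sub>R ?p) (2 *\<^sub>R ?q)"
      unfolding in_segment by (intro conjI exI[of _ "1/2"]) (simp_all add: pq)
    then show ?thesis using face p q \<open>x \<in> F\<close> unfolding face_of_def by blast
  qed
  then obtain c where c: "2 *\<^sub>R ?p = c *\<^sub>R x" "0 \<le> c" by (auto simp: x(2) conic_hull_singleton)
  have "0 < c" using c k(2) by (cases "c = 0") auto
  have tk: "0 < t k" using t(2) k by (cases "t k = 0") (auto simp: less_le)
  have "x = (1 / c) *\<^sub>R (c *\<^sub>R x)" using \<open>0 < c\<close> by simp
  also have "\<dots> = (2 * t k / c) *\<^sub>R rs ! k" unfolding c(1)[symmetric] by simp
  finally have xr: "x = (2 * t k / c) *\<^sub>R rs ! k" .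
  have "conic hull {x} = conic hull {rs ! k}"
  proof -
    define b where "b = 2 * t k / c"
    have b: "0 < b" "x = b *\<^sub>R rs ! k" using tk \<open>0 < c\<close> xr by (auto simp: b_def)
    have "a *\<^sub>R rs ! k = (a / b) *\<^sub>R x" "0 \<le> a / b" if "0 \<le> a" for a using b that by auto
    moreover have "a *\<^sub>R x = (a * b) *\<^sub>R rs ! k" "0 \<le> a * b" if "0 \<le> a" for a using b that by auto
    ultimately show ?thesis unfolding conic_hull_singleton by blast
  qed
  then show ?thesis using that[of "rs ! k"] k rs(1) x(2) by auto
qed

text \<open>The extreme rays are exactly the rays through the generators, so the representatives \<open>R\<close> are positive
  multiples of the generators, and generate the same cone. Independence follows by counting: \<open>R\<close> has
  at most as many elements as its span has dimensions.\<close>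

lemma is_Ray_simplicial_cone:
  assumes "simplicial_cone k S" "is_Ray S R"
  shows "finite R" "independent R" "S = convex_cone hull (R :: 'a::euclidean_space set)"
proof -
  obtain R0 where R0: "independent R0" "S = convex_cone hull R0"
    using assms(1) by (auto simp: simplicial_cone_def)
  have fin0: "finite R0" using R0(1) by (rule finiteI_independent)
  have in_R: "\<exists>r0\<in>R0. r \<in> conic hull {r0} \<and> r \<noteq> 0" if rR: "r \<in> R" for r
  proof -
    obtain F where "F extreme_ray_of S" "r \<in> F" "r \<noteq> 0" 
      using assms(2)[unfolded is_Ray_def, THEN conjunct1, rule_format, OF rR] by blast
    obtain r0 where "r0 \<in> R0" "F = conic hull {r0}"
      by (rule extreme_ray_of_cone_generated[OF fin0 \<open>F extreme_ray_of S\<close>[unfolded R0(2)]])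
    with \<open>r \<in> F\<close> \<open>r \<noteq> 0\<close> show ?thesis by blast
  qed
  have ex1: "\<exists>!r. r \<in> R \<and> r \<in> conic hull {r0}" if "r0 \<in> R0" for r0
    using assms(2)[unfolded is_Ray_def, THEN conjunct2, rule_format]
      extreme_ray_of_generator[OF R0(1) that, folded R0(2)] .
  define \<phi> where "\<phi> r0 = (THE r. r \<in> R \<and> r \<in> conic hull {r0})" for r0
  have \<phi>: "\<phi> r0 \<in> R \<and> \<phi> r0 \<in> conic hull {r0}" if "r0 \<in> R0" for r0
    unfolding \<phi>_def by (rule theI'[OF ex1[OF that]])
  have R_eq: "R = \<phi> ` R0"
  proof (intro equalityI subsetI)
    fix r assume "r \<in> R"
    then obtain r0 where "r0 \<in> R0" "r \<in> conic hull {r0}" using in_R by blast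
    then have "\<phi> r0 = r"
      unfolding \<phi>_def using \<open>r \<in> R\<close> by (intro the1_equality ex1) auto
    with \<open>r0 \<in> R0\<close> show "r \<in> \<phi> ` R0" by blast
  qed (use \<phi> in auto)
  then show "finite R" using fin0 by simp
  have scale: "\<exists>c>0. \<phi> r0 = c *\<^sub>R r0" if r0: "r0 \<in> R0" for r0
  proof -
    obtain c where c: "\<phi> r0 = c *\<^sub>R r0" "0 \<le> c" using \<phi>[OF r0] by (auto simp: conic_hull_singleton)
    have "\<phi> r0 \<noteq> 0" using in_R \<phi>[OF r0] by blast
    then show ?thesis using c by (intro exI[of _ c]) (auto simp: less_le)
  qed
  have R0_cone: "r0 \<in> convex_cone hull R" if r0: "r0 \<in> R0" for r0
  proof -
    obtain c where c: "0 < c" "\<phi> r0 = c *\<^sub>R r0" using scale[OF r0] by blast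
    then have "r0 = (1 / c) *\<^sub>R \<phi> r0" by simp
    also have "\<dots> \<in> convex_cone hull R"
      using c \<phi>[OF r0] by (intro convex_cone_hull_mul hull_inc) auto
    finally show ?thesis .
  qed
  have R_cone: "r \<in> convex_cone hull R0" if rR: "r \<in> R" for r
  proof -
    obtain r0 where r0: "r0 \<in> R0" "r = \<phi> r0" using rR R_eq by blast
    obtain c where "0 < c" "r = c *\<^sub>R r0" using scale[OF r0(1)] r0(2) by blast
    then show ?thesis using r0(1) by (simp add: convex_cone_hull_mul hull_inc)
  qed
  have eq: "convex_cone hull R0 = convex_cone hull R"
  proof
    show "convex_cone hull R0 \<subseteq> convex_cone hull R"
      by (rule hull_minimal) (use R0_cone convex_cone_convex_cone_hull in auto)
    show "convex_cone hull R \<subseteq> convex_cone hull R0"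
      by (rule hull_minimal) (use R_cone convex_cone_convex_cone_hull in auto)
  qed
  then show "S = convex_cone hull R" using R0(2) by simp
  have "span R0 = span R" using eq span_convex_cone_hull by metis
  then have "dim R0 = dim R" by (metis dim_span)
  then have "card R \<le> dim R"
    using card_image_le[OF fin0, of \<phi>] dim_eq_card_independent[OF R0(1)] R_eq[symmetric] by simp
  then show "independent R"
    by (intro card_le_dim_spanning[of R R]) (simp_all add: span_superset \<open>finite R\<close>)
qed

section \<open>Probabilities and conditional means\<close>

lemma uniform_case:
  fixes c :: "'w \<Rightarrow> 'a::euclidean_space"
  assumes M: "prob_space M" and c: "c \<in> borel_measurable M"
    and Q: "polytope Q" "aff_dim Q = int d"
    and law: "distr M borel c = uniform_measure (aff_lebesgue Q) Q"
    and S: "n simplex S" "S \<subseteq> Q" "aff_dim S = aff_dim Q"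
  shows "check_p M c S = aff_volume S / aff_volume Q"
    and "check_c M c S = (1 / (real d + 1)) *\<^sub>R (\<Sum>v\<in>Vert S. v)"
proof -
  obtain C where C: "\<not> affine_dependent C" "S = convex hull C"
    using S(1) by (auto simp: simplex)
  have "aff_dim S = int (card C) - 1"
    using C aff_dim_affine_independent[OF C(1)] by (simp add: aff_dim_convex_hull)
  then have card: "card C = Suc d" using S(3) Q(2) by simp
  note simplex = simplex_integrals[OF C(1) card C(2)]
  have "S \<noteq> {}" using card C(2) by auto
  then have \<mu>: "aff_lebesgue Q = aff_lebesgue S"
    using aff_lebesgue_cong[OF S(2) _ S(3)] by simp
  have sets: "sets (aff_lebesgue S) = sets borel" by (simp add: aff_lebesgue_def Let_def)
  have Q_borel: "Q \<in> sets borel" using Q(1) by (simp add: borel_compact polytope_imp_compact)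
  have S_borel: "S \<in> sets borel"
    unfolding C(2) by (intro borel_compact finite_imp_compact_convex_hull aff_independent_finite[OF C(1)])
  \<comment> \<open>the uniform measure has total mass one, which excludes volume zero or infinity by the conventions
    for division in the extended reals\<close>
  have vQ: "0 < aff_volume Q \<and> emeasure (aff_lebesgue Q) Q = ennreal (aff_volume Q)"
  proof -
    have "emeasure (distr M borel c) UNIV = 1"
      using prob_space.emeasure_space_1[OF prob_space.prob_space_distr[OF M c]] by simp
    then have "emeasure (aff_lebesgue Q) (Q \<inter> UNIV) / emeasure (aff_lebesgue Q) Q = 1"
      unfolding law by (subst (asm) emeasure_uniform_measure) (use Q_borel sets \<mu> in auto)
    then have "emeasure (aff_lebesgue Q) Q \<noteq> 0" "emeasure (aff_lebesgue Q) Q \<noteq> \<top>"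
      by (auto simp: ennreal_divide_top)
    then show ?thesis
      by (simp add: aff_volume_def measure_def enn2real_positive_iff less_top zero_less_iff_neq_zero)
  qed
  define h where "h x = indicator Q x / aff_volume Q" for x
  have law': "distr M borel c = density (aff_lebesgue S) (\<lambda>x. ennreal (h x))"
    unfolding law uniform_measure_def h_def \<mu>[symmetric] using vQ
    by (simp add: divide_ennreal[symmetric] ennreal_indicator)
  have h: "h \<in> borel_measurable borel" "\<And>x. 0 \<le> h x"
    using Q_borel vQ unfolding h_def by (auto intro!: divide_nonneg_pos)
  note chk = check_density[OF M c law' sets h S_borel simplex(3)]
  have ind: "indicator S x * h x = indicator S x / aff_volume Q" for x
    using S(2) by (auto simp: h_def indicator_def)
  have sp: "space (aff_lebesgue S) = UNIV" using sets_eq_imp_space_eq[OF sets] by simp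
  show p: "check_p M c S = aff_volume S / aff_volume Q"
    unfolding chk(1) ind by (simp add: sp aff_volume_def)
  have "(\<integral>x. (indicator S x * h x) *\<^sub>R x \<partial>aff_lebesgue S)
      = (\<integral>x. (1 / aff_volume Q) *\<^sub>R (indicator S x *\<^sub>R x) \<partial>aff_lebesgue S)"
    unfolding ind by (simp add: mult.commute)
  also have "\<dots> = (1 / aff_volume Q) *\<^sub>R (\<integral>x. indicator S x *\<^sub>R x \<partial>aff_lebesgue S)"
    by (rule integral_scaleR_right)
  finally have "check_c M c S = (aff_volume Q / aff_volume S * (1 / aff_volume Q) * (aff_volume S / (real d + 1))) *\<^sub>R (\<Sum>v\<in>C. v)"
    unfolding chk(2) p simplex(2) by simp
  also have "aff_volume Q / aff_volume S * (1 / aff_volume Q) * (aff_volume S / (real d + 1)) = 1 / (real d + 1)"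
    using vQ simplex(1) by simp
  also have "C = Vert S"
    unfolding Vert_def C(2) extreme_point_of_convex_hull_affine_independent[OF C(1)] by simp
  finally show "check_c M c S = (1 / (real d + 1)) *\<^sub>R (\<Sum>v\<in>Vert S. v)" .
qed

lemma exponential_case:
  fixes c :: "'w \<Rightarrow> 'a::euclidean_space"
  assumes M: "prob_space M" and c: "c \<in> borel_measurable M"
    and K: "polyhedral_cone K" and int: "set_integrable (aff_lebesgue K) K (\<lambda>x. exp (\<theta> \<bullet> x))"
    and law: "distr M borel c = exp_law K \<theta>"
    and S: "simplicial_cone k S" "S \<subseteq> K" "aff_dim S = aff_dim K"
  shows "check_p M c S = exp_integral S \<theta> / exp_integral K \<theta>"
    and "is_Ray S (set rs) \<Longrightarrow> distinct rs \<Longrightarrow> orthonormal_frame (span S) bs \<Longrightarrow>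
      exp_integral S \<theta> = \<bar>Determinant.det (ray_matrix bs rs)\<bar> * (\<Prod>r\<in>set rs. 1 / - (r \<bullet> \<theta>))"
    and "is_Ray S R \<Longrightarrow> check_c M c S = (\<Sum>r\<in>R. (1 / - (r \<bullet> \<theta>)) *\<^sub>R r)"
proof -
  obtain R0 where R0: "independent R0" "S = convex_cone hull R0"
    using S(1) by (auto simp: simplicial_cone_def)
  have "S \<noteq> {}" unfolding R0(2) by (rule convex_cone_hull_nonempty)
  then have \<mu>: "aff_lebesgue K = aff_lebesgue S"
    using aff_lebesgue_cong[OF S(2) _ S(3)] by simp
  have sets: "sets (aff_lebesgue S) = sets borel" by (simp add: aff_lebesgue_def Let_def)
  have K_borel: "K \<in> sets borel"
    using K by (simp add: polyhedral_cone_def borel_closed polyhedron_imp_closed)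
  have "closed S" unfolding R0(2) by (intro closed_convex_cone_hull finiteI_independent R0(1))
  then have S_borel: "S \<in> sets borel" by (rule borel_closed)
  have intS: "set_integrable (aff_lebesgue S) S (\<lambda>x. exp (\<theta> \<bullet> x))"
    using set_integrable_subset[OF int _ S(2)] S_borel sets \<mu> by simp
  obtain cs where cs: "orthonormal_frame (span S) cs"
    using ex_orthonormal_frame[OF subspace_span] by blast
  have gen: "independent R \<Longrightarrow> S = convex_cone hull R \<Longrightarrow> \<exists>rs. set rs = R \<and> distinct rs" for R :: "'a set"
    by (simp add: finite_distinct_list finiteI_independent)
  obtain rs0 where rs0: "set rs0 = R0" "distinct rs0" using gen[OF R0] by blast
  note cone0 = cone_integrals[OF rs0(2) R0(1)[folded rs0(1)] R0(2)[folded rs0(1)] cs intS]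
  let ?E = "\<lambda>S. exp_integral S \<theta>"
  have K_int: "?E K = (\<integral>x. indicator K x * exp (\<theta> \<bullet> x) \<partial>aff_lebesgue S)"
    by (simp add: exp_integral_def set_lebesgue_integral_def \<mu>)
  have S_int: "?E S = (\<integral>x. indicator S x * exp (\<theta> \<bullet> x) \<partial>aff_lebesgue S)"
    by (simp add: exp_integral_def set_lebesgue_integral_def)
  have "?E S \<le> ?E K"
    unfolding K_int S_int using int intS S(2)
    by (intro integral_mono) (auto simp: set_integrable_def \<mu> indicator_def)
  then have K_pos: "0 < ?E K" using cone0(2) by simp
  define h where "h x = exp (\<theta> \<bullet> x) * indicator K x / ?E K" for x
  have law': "distr M borel c = density (aff_lebesgue S) (\<lambda>x. ennreal (h x))"
    by (simp add: law exp_law_def \<mu> h_def)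
  have h: "h \<in> borel_measurable borel" "\<And>x. 0 \<le> h x"
    using K_borel K_pos unfolding h_def by (auto intro!: divide_nonneg_pos)
  note chk = check_density[OF M c law' sets h S_borel cone0(4)]
  have ind: "indicator S x * h x = indicator S x * exp (\<theta> \<bullet> x) / ?E K" for x
    using S(2) by (auto simp: h_def indicator_def)
  show p: "check_p M c S = ?E S / ?E K"
    unfolding chk(1) ind S_int by simp
  show "?E S = \<bar>Determinant.det (ray_matrix bs rs)\<bar> * (\<Prod>r\<in>set rs. 1 / - (r \<bullet> \<theta>))"
    if "is_Ray S (set rs)" "distinct rs" "orthonormal_frame (span S) bs"
    using cone_integrals(1)[OF that(2) is_Ray_simplicial_cone(2,3)[OF S(1) that(1)] that(3) intS] .
  show "check_c M c S = (\<Sum>r\<in>R. (1 / - (r \<bullet> \<theta>)) *\<^sub>R r)" if R: "is_Ray S R"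
  proof -
    note gens = is_Ray_simplicial_cone(2,3)[OF S(1) R]
    obtain rs where rs: "set rs = R" "distinct rs" using gen[OF gens] by blast
    note cone = cone_integrals[OF rs(2) gens[folded rs(1)] cs intS]
    have "(\<integral>x. (indicator S x * h x) *\<^sub>R x \<partial>aff_lebesgue S)
        = (\<integral>x. (1 / ?E K) *\<^sub>R ((indicator S x * exp (\<theta> \<bullet> x)) *\<^sub>R x) \<partial>aff_lebesgue S)"
      unfolding ind by (simp add: mult.commute)
    also have "\<dots> = (1 / ?E K) *\<^sub>R (\<integral>x. (indicator S x * exp (\<theta> \<bullet> x)) *\<^sub>R x \<partial>aff_lebesgue S)"
      by (rule integral_scaleR_right)
    finally have "check_c M c S = (?E K / ?E S * (1 / ?E K) * ?E S) *\<^sub>R (\<Sum>r\<in>R. (1 / - (r \<bullet> \<theta>)) *\<^sub>R r)"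
      unfolding chk(2) p cone(3) rs(1) by simp
    also have "?E K / ?E S * (1 / ?E K) * ?E S = 1" using K_pos cone0(2) by simp
    finally show ?thesis by simp
  qed
qed

theorem mainTheorem7:
  fixes M :: "'w measure" and c :: "'w \<Rightarrow> real ^ 'm"
  assumes "prob_space M" and "c \<in> borel_measurable M"
  shows "(\<forall>Q S d.
      polytope Q \<and> aff_dim Q = int d \<and>
      distr M borel c = uniform_measure (aff_lebesgue Q) Q \<and>
      (\<exists>n. n simplex S) \<and> S \<subseteq> Q \<and> aff_dim S = aff_dim Q \<longrightarrow>
        check_p M c S = aff_volume S / aff_volume Q \<and>
        check_c M c S = (1 / (real d + 1)) *\<^sub>R (\<Sum>v\<in>Vert S. v))
    \<and>
    (\<forall>K \<theta> S.
      polyhedral_cone K \<and> \<theta> \<in> rel_interior (polar_cone K) \<and>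
      set_integrable (aff_lebesgue K) K (\<lambda>x. exp (\<theta> \<bullet> x)) \<and>
      distr M borel c = exp_law K \<theta> \<and>
      (\<exists>k. simplicial_cone k S) \<and> S \<subseteq> K \<and> aff_dim S = aff_dim K \<longrightarrow>
        check_p M c S = exp_integral S \<theta> / exp_integral K \<theta> \<and>
        (\<forall>R. is_Ray S R \<longrightarrow>
          (\<forall>rs bs. distinct rs \<and> set rs = R \<and>
              distinct bs \<and> orthonormal_basis_of (span S) (set bs) \<longrightarrow>
            exp_integral S \<theta> / exp_integral K \<theta> =
              \<bar>Determinant.det (ray_matrix bs rs)\<bar> / exp_integral K \<theta> * (\<Prod>r\<in>R. 1 / (- (r \<bullet> \<theta>)))) \<and>
          check_c M c S = (\<chi> i. \<Sum>r\<in>R. - (r $ i) / (r \<bullet> \<theta>))))"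
proof (intro conjI allI impI)
  fix Q S :: "(real ^ 'm) set" and d :: nat
  assume A: "polytope Q \<and> aff_dim Q = int d \<and>
      distr M borel c = uniform_measure (aff_lebesgue Q) Q \<and>
      (\<exists>n. n simplex S) \<and> S \<subseteq> Q \<and> aff_dim S = aff_dim Q"
  then obtain n where "n simplex S" by blast
  note u = uniform_case[OF assms _ _ _ this]
  show "check_p M c S = aff_volume S / aff_volume Q" using A by (intro u) auto
  show "check_c M c S = (1 / (real d + 1)) *\<^sub>R (\<Sum>v\<in>Vert S. v)" using A by (intro u) auto
next
  fix K S :: "(real ^ 'm) set" and \<theta> :: "real ^ 'm"
  assume A: "polyhedral_cone K \<and> \<theta> \<in> rel_interior (polar_cone K) \<and>
      set_integrable (aff_lebesgue K) K (\<lambda>x. exp (\<theta> \<bullet> x)) \<and>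
      distr M borel c = exp_law K \<theta> \<and>
      (\<exists>k. simplicial_cone k S) \<and> S \<subseteq> K \<and> aff_dim S = aff_dim K"
  then obtain k where k: "simplicial_cone k S" by blast
  from A have A': "polyhedral_cone K" "set_integrable (aff_lebesgue K) K (\<lambda>x. exp (\<theta> \<bullet> x))"
    "distr M borel c = exp_law K \<theta>" "S \<subseteq> K" "aff_dim S = aff_dim K" by blast+
  note e = exponential_case[OF assms A'(1-3) k A'(4,5)]
  show "check_p M c S = exp_integral S \<theta> / exp_integral K \<theta>" by (rule e(1))
  fix R assume R: "is_Ray S R"
  show "exp_integral S \<theta> / exp_integral K \<theta> =
      \<bar>Determinant.det (ray_matrix bs rs)\<bar> / exp_integral K \<theta> * (\<Prod>r\<in>R. 1 / (- (r \<bullet> \<theta>)))"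
    if "distinct rs \<and> set rs = R \<and> distinct bs \<and> orthonormal_basis_of (span S) (set bs)" for rs bs
    using e(2)[of rs bs] R that by (simp add: orthonormal_frame_def)
  show "check_c M c S = (\<chi> i. \<Sum>r\<in>R. - (r $ i) / (r \<bullet> \<theta>))"
    unfolding e(3)[OF R] by (simp add: Finite_Cartesian_Product.vec_eq_iff)
qed

end
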